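(* Let $\mathbb{F}$ be a field of characteristic $0$, $k\ge2$, and $\vec d=(d_1,\dots,d_k)$ a sequence of positive integers. Then the nilpotency degree of $\mathfrak{n}(C)$ is $k-1$ except when $r_{1,k}=0$. The equality $r_{1,k}=0$ occurs if and only if one of the following holds: (1) $\vec d=(1,\dots,1)$, in which case $\mathfrak{n}(C)$ is $1$-dimensional abelian; (2) $k$ is odd and $\vec d$ is odd-symmetric with $d_1=d_k=1$, in which case, if $\vec d\neq(1,\dots,1)$, the nilpotency degree of $\mathfrak{n}(C)$ is $k-2$. In addition, $r_{1,k}=2$ if and only if $k$ is odd and $\vec d$ is odd-symmetric with $d_1=d_k>1$.
   Context: Put $d=d_1+\cdots+d_k$ and regard matrices in $\mathfrak{gl}(d)=\mathfrak{gl}(d,\mathbb{F})$ as partitioned into blocks according to $\vec d$; $p_{i,j}:\mathfrak{gl}(d)\to M_{d_i\times d_j}$ is the projection onto the $(i,j)$ block. $J^p(0)$ is the upper triangular nilpotent Jordan block of size $p$. $D=J^{d_1}(0)\oplus\cdots\oplus J^{d_k}(0)$. $E\in\mathfrak{gl}(d)$ is the block matrix whose $(i,i+1)$ block, $1\le i\le k-1$, is $C(i)\in M_{d_i\times d_{i+1}}$, the matrix with entry $1$ in position $(d_i,1)$ and $0$ elsewhere, and all of whose other blocks are $0$ ($C=(C(1),\dots,C(k-1))$ is the canonical sequence). $\mathfrak{h}$ is the Lie subalgebra of $\mathfrak{gl}(d)$ generated by $D$ and $E$, and $\mathfrak{n}(C)$ is the Lie subalgebra generated by all $(\mathrm{ad}\,D)^lE$,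 $l\ge0$. For $1\le i<j\le k$: $r_{i,j}=0$ if $p_{i,j}(X)=0$ for all $X\in\mathfrak{h}$; otherwise $r_{i,j}=\min\{\mathrm{rk}(p_{i,j}(X)):X\in\mathfrak{h},\ p_{i,j}(X)\neq0\}$. $\vec d$ is odd-symmetric if $d_i=d_{k+1-i}$ for all $i$, $k$ is odd and $d_{(k+1)/2}$ is odd. Lower central series: $\mathfrak{g}^0=\mathfrak{g}$, $\mathfrak{g}^{i+1}=[\mathfrak{g},\mathfrak{g}^i]$; the nilpotency degree is the least $m$ with $\mathfrak{g}^m=0$.
   Formalization: In the criterion for r_{1,k}=0, alternative (1) d=(1,…,1) is required to have k≥3, because for k=2, d=(1,1) one has D=0, p_{1,2}(E)=(1)≠0 and so r_{1,2}=1; all other clauses are as stated for k≥2. *)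

theory Defs
  imports
    "HOL.Hull"
    "Jordan_Normal_Form.Jordan_Normal_Form"
    "Jordan_Normal_Form.DL_Rank"
begin

text \<open>
  A sequence \<open>d\<^sub>1, \<dots>, d\<^sub>k\<close> is a number \<open>k\<close> together with a function \<open>d :: nat \<Rightarrow> nat\<close> of which only
  the values at \<open>1, \<dots>, k\<close> matter; block indices start at 1. Matrix entries are indexed from 0, as
  in the library.
\<close>

definition total_size :: "nat \<Rightarrow> (nat \<Rightarrow> nat) \<Rightarrow> nat" where
  "total_size k d = (\<Sum>i\<in>{1..k}. d i)"

definition offset :: "(nat \<Rightarrow> nat) \<Rightarrow> nat \<Rightarrow> nat" where
  "offset d i = (\<Sum>l\<in>{1..<i}. d l)"

definition block_range :: "(nat \<Rightarrow> nat) \<Rightarrow> nat \<Rightarrow> nat set" where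
  "block_range d i = {offset d i..<offset d i + d i}"

definition block_proj :: "(nat \<Rightarrow> nat) \<Rightarrow> nat \<Rightarrow> nat \<Rightarrow> 'a mat \<Rightarrow> 'a mat" where
  "block_proj d i j X = mat (d i) (d j) (\<lambda>(r, c). X $$ (offset d i + r, offset d j + c))"

definition odd_symmetric :: "nat \<Rightarrow> (nat \<Rightarrow> nat) \<Rightarrow> bool" where
  "odd_symmetric k d \<longleftrightarrow>
    (\<forall>i\<in>{1..k}. d i = d (k + 1 - i)) \<and> odd k \<and> odd (d ((k + 1) div 2))"


definition mat_bracket :: "'a::ring_1 mat \<Rightarrow> 'a mat \<Rightarrow> 'a mat" where
  "mat_bracket X Y = X * Y - Y * X"

definition lie_subalgebra :: "nat \<Rightarrow> 'a::field mat set \<Rightarrow> bool" where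
  "lie_subalgebra n L \<longleftrightarrow>
    VectorSpace.subspace class_ring L (module_mat TYPE('a) n n) \<and>
    (\<forall>X\<in>L. \<forall>Y\<in>L. mat_bracket X Y \<in> L)"

definition lie_generated :: "nat \<Rightarrow> 'a::field mat set \<Rightarrow> 'a mat set" where
  "lie_generated n S = lie_subalgebra n hull S"

definition lie_abelian :: "nat \<Rightarrow> 'a::ring_1 mat set \<Rightarrow> bool" where
  "lie_abelian n L \<longleftrightarrow> (\<forall>X\<in>L. \<forall>Y\<in>L. mat_bracket X Y = 0\<^sub>m n n)"

definition mat_subspace_dim :: "nat \<Rightarrow> 'a::field mat set \<Rightarrow> nat" where
  "mat_subspace_dim n L =
    vectorspace.dim class_ring ((module_mat TYPE('a) n n)\<lparr>carrier := L\<rparr>)"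

fun lower_central :: "nat \<Rightarrow> 'a::field mat set \<Rightarrow> nat \<Rightarrow> 'a mat set" where
  "lower_central n L 0 = L"
| "lower_central n L (Suc i) =
    LinearCombinations.module.span class_ring (module_mat TYPE('a) n n)
      {mat_bracket X Y | X Y. X \<in> L \<and> Y \<in> lower_central n L i}"

text \<open>A relation rather than a \<open>LEAST\<close>, so that it entails that \<open>L\<close> is nilpotent.\<close>

definition has_nilpotency_degree :: "nat \<Rightarrow> 'a::field mat set \<Rightarrow> nat \<Rightarrow> bool" where
  "has_nilpotency_degree n L m \<longleftrightarrow>
    lower_central n L m = {0\<^sub>m n n} \<and> (\<forall>i<m. lower_central n L i \<noteq> {0\<^sub>m n n})"


definition D_mat :: "nat \<Rightarrow> (nat \<Rightarrow> nat) \<Rightarrow> 'a::field mat" where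
  "D_mat k d = jordan_matrix (map (\<lambda>i. (d i, 0)) [1..<k + 1])"

definition canonical_seq :: "(nat \<Rightarrow> nat) \<Rightarrow> nat \<Rightarrow> 'a::field mat" where
  "canonical_seq d i =
    mat (d i) (d (i + 1)) (\<lambda>(r, c). if r = d i - 1 \<and> c = 0 then 1 else 0)"

text \<open>
  The block matrix whose \<open>(i, i + 1)\<close> block is \<open>A i\<close> for \<open>1 \<le> i \<le> k - 1\<close>, all other blocks being 0.
\<close>

definition superdiag_mat :: "nat \<Rightarrow> (nat \<Rightarrow> nat) \<Rightarrow> (nat \<Rightarrow> 'a::field mat) \<Rightarrow> 'a mat" where
  "superdiag_mat k d A = mat (total_size k d) (total_size k d) (\<lambda>(r, c).
    \<Sum>i\<in>{1..<k}. if r \<in> block_range d i \<and> c \<in> block_range d (i + 1)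
                 then A i $$ (r - offset d i, c - offset d (i + 1)) else 0)"

definition E_mat :: "nat \<Rightarrow> (nat \<Rightarrow> nat) \<Rightarrow> 'a::field mat" where
  "E_mat k d = superdiag_mat k d (canonical_seq d)"

definition h_alg :: "nat \<Rightarrow> (nat \<Rightarrow> nat) \<Rightarrow> 'a::field mat set" where
  "h_alg k d = lie_generated (total_size k d) {D_mat k d, E_mat k d}"

definition n_alg :: "nat \<Rightarrow> (nat \<Rightarrow> nat) \<Rightarrow> 'a::field mat set" where
  "n_alg k d = lie_generated (total_size k d)
    {((mat_bracket (D_mat k d)) ^^ l) (E_mat k d) | l. True}"

definition min_block_rank :: "'a::field itself \<Rightarrow> nat \<Rightarrow> (nat \<Rightarrow> nat) \<Rightarrow> nat \<Rightarrow> nat \<Rightarrow> nat" where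
  "min_block_rank _ k d i j =
    (if \<forall>X \<in> (h_alg k d :: 'a mat set). block_proj d i j X = 0\<^sub>m (d i) (d j) then 0
     else Min {vec_space.rank (d i) (block_proj d i j X) | X.
                 X \<in> (h_alg k d :: 'a mat set) \<and> block_proj d i j X \<noteq> 0\<^sub>m (d i) (d j)})"

end

theory Submission
  imports Defs
begin

text \<open>
  \<open>D + E\<close> is a single nilpotent Jordan block of size \<open>N = d\<^sub>1 + \<dots> + d\<^sub>k\<close>, so the superdiagonal of
  \<open>(D, E)\<close> is a word \<open>w = D\<dots>DED\<dots>DE\<dots>D\<close> of length \<open>N - 1\<close>. If \<open>P\<close> is a Lie polynomial in two letters,
  the \<open>(r, c)\<close> entry of \<open>P(D, E)\<close> is the coefficient in \<open>P\<close> of the factor of \<open>w\<close> between positions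
  \<open>r\<close> and \<open>c\<close>. By a theorem of Duchamp and Thibon, a word in two letters that contains both of them has
  non-zero coefficient in some Lie polynomial unless it is a palindrome of even length; and \<open>w\<close> is
  a palindrome of even length exactly when \<open>d\<close> is odd-symmetric. If it is not and some \<open>d\<^sub>i > 1\<close>, a Lie polynomial
  of length \<open>N - 1\<close> yields an element of \<open>\<hh>\<close> whose only non-zero entry is in the upper right corner,
  so \<open>r\<^sub>1\<^sub>,\<^sub>k = 1\<close>.

  If \<open>w\<close> is a palindrome of even length, every element of \<open>\<hh>\<close> is skew-adjoint for a non-degenerate
  symmetric form, which makes its \<open>(1, k)\<close> block skew up to reordering of rows and signs; hence the rank
  is even. The block vanishes if \<open>d\<^sub>1 = 1\<close>, and otherwise the
  factor \<open>DED\<dots>DE\<close> of odd length gives an element of rank 2. The nilpotency degree is read off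
  from the grading by the number of letters \<open>E\<close>.
\<close>

section \<open>The support of the free Lie algebra on two letters\<close>

text \<open>If \<open>Q\<close> holds the coefficients of a noncommutative polynomial, these are the
  coefficients of its commutator \<open>x Q - Q x\<close> with the letter \<open>x\<close>: a word
  arises by putting \<open>x\<close> in front or, with a minus sign, at the end.\<close>

definition ad_coeff :: "'a \<Rightarrow> ('a list \<Rightarrow> int) \<Rightarrow> 'a list \<Rightarrow> int" where
  "ad_coeff x Q w =
    (if w \<noteq> [] \<and> hd w = x then Q (tl w) else 0) -
    (if w \<noteq> [] \<and> last w = x then Q (butlast w) else 0)"

text \<open>
  \<open>lie_coeff xs w\<close> is the coefficient of the word \<open>w\<close> in the right-normed bracket
  \<open>[x\<^sub>1, [x\<^sub>2, \<dots> [x\<^sub>m\<^sub>-\<^sub>1, x\<^sub>m]]]\<close> of the letters \<open>xs\<close>.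
\<close>

fun lie_coeff :: "'a list \<Rightarrow> 'a list \<Rightarrow> int" where
  "lie_coeff [] w = 0"
| "lie_coeff [x] w = of_bool (w = [x])"
| "lie_coeff (x # y # zs) w = ad_coeff x (lie_coeff (y # zs)) w"

lemma lie_coeff_Cons: "xs \<noteq> [] \<Longrightarrow> lie_coeff (x # xs) = ad_coeff x (lie_coeff xs)"
  by (cases xs) auto

lemma lie_coeff_replicate:
  "xs \<noteq> [] \<Longrightarrow> lie_coeff (replicate m x @ xs) = (ad_coeff x ^^ m) (lie_coeff xs)"
  by (induction m) (auto simp: lie_coeff_Cons)

text \<open>Each commutator adds its own letter at one end, so brackets are homogeneous in every
  letter. Both the length and the number of letters \<open>E\<close> are read off from this.\<close>

lemma lie_coeff_mset:
  "lie_coeff xs w \<noteq> 0 \<Longrightarrow> mset w = mset xs"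
proof (induction xs arbitrary: w)
  case (Cons x xs)
  show ?case
  proof (cases "xs = []")
    case False
    then have "ad_coeff x (lie_coeff xs) w \<noteq> 0"
      using Cons.prems by (simp add: lie_coeff_Cons)
    then have w: "w \<noteq> []"
      and "hd w = x \<and> lie_coeff xs (tl w) \<noteq> 0 \<or> last w = x \<and> lie_coeff xs (butlast w) \<noteq> 0"
      by (auto simp: ad_coeff_def split: if_splits)
    then consider "hd w = x" "mset (tl w) = mset xs" | "last w = x" "mset (butlast w) = mset xs"
      using Cons.IH by blast
    then show ?thesis
    proof cases
      case 1
      then show ?thesis using w by (cases w) auto
    next
      case 2
      have "mset w = mset (butlast w @ [last w])" using w by simp
      also have "\<dots> = add_mset (last w) (mset (butlast w))"
        by (simp del: append_butlast_last_id)
      finally show ?thesis using 2 by simp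
    qed
  qed (use Cons.prems in auto)
qed auto

lemma lie_coeff_length: "lie_coeff xs w \<noteq> 0 \<Longrightarrow> length w = length xs"
  using lie_coeff_mset mset_eq_length by blast

lemma tl_rev: "tl (rev w) = rev (butlast w)"
  by (metis butlast_rev rev_rev_ident)

lemma ad_coeff_rev:
  assumes "\<And>w. Q (rev w) = e * Q w"
  shows "ad_coeff x Q (rev w) = - e * ad_coeff x Q w"
proof (cases "w = []")
  case False
  have "tl (rev w) = rev (butlast w)" "butlast (rev w) = rev (tl w)"
    by (simp_all add: butlast_rev tl_rev)
  then show ?thesis
    using assms[of "tl w"] assms[of "butlast w"] False
    by (simp add: ad_coeff_def hd_rev last_rev algebra_simps)
qed (simp add: ad_coeff_def)

text \<open>Each of the \<open>length xs - 1\<close> commutators contributes a sign under reversal.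
  Hence a palindrome of even length has coefficient 0 in every bracket.\<close>

lemma lie_coeff_rev: "lie_coeff xs (rev w) = (-1) ^ (length xs + 1) * lie_coeff xs w"
proof (induction xs arbitrary: w)
  case (Cons x xs)
  show ?case
  proof (cases "xs = []")
    case False
    then show ?thesis
      using ad_coeff_rev[of "lie_coeff xs" "(-1) ^ (length xs + 1)" x w, OF Cons.IH]
      by (simp add: lie_coeff_Cons)
  next
    case True
    have "(rev w = [x]) = (w = [x])" by (metis rev_rev_ident rev_singleton_conv)
    then show ?thesis using True by simp
  qed
qed auto

section \<open>Commutators with a power of one letter\<close>

lemma ad_coeff_both_ends:
  assumes "s \<noteq> []" "hd s \<noteq> x" "last s \<noteq> x"
  shows "ad_coeff x Q (replicate p x @ s @ replicate q x) =
    (if p > 0 then Q (replicate (p - 1) x @ s @ replicate q x) else 0) -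
    (if q > 0 then Q (replicate p x @ s @ replicate (q - 1) x) else 0)"
proof -
  have 1: "hd (replicate p x @ s @ replicate q x) = x \<longleftrightarrow> p > 0"
    using assms by (cases p) auto
  have 2: "last (replicate p x @ s @ replicate q x) = x \<longleftrightarrow> q > 0"
    using assms by (cases q) (auto simp: last_append)
  have 3: "p > 0 \<Longrightarrow> tl (replicate p x @ s @ replicate q x) = replicate (p - 1) x @ s @ replicate q x"
    by (cases p) auto
  have 4: "q > 0 \<Longrightarrow> butlast (replicate p x @ s @ replicate q x) = replicate p x @ s @ replicate (q - 1) x"
    by (cases q) (auto simp: butlast_append simp flip: replicate_append_same)
  show ?thesis
    using assms(1) 1 2 3 4 by (auto simp: ad_coeff_def)
qed

text \<open>The \<open>(p + q)\<close>-fold commutator expands into terms \<open>x^i Q x^j\<close>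
  with signed binomial coefficients. As \<open>s\<close> neither begins nor ends with
  \<open>x\<close>, only \<open>i = p\<close>, \<open>j = q\<close> contributes. The induction step
  is Pascal's rule.\<close>

lemma ad_coeff_strip:
  assumes "s \<noteq> []" "hd s \<noteq> x" "last s \<noteq> x"
  shows "(ad_coeff x ^^ (p + q)) Q (replicate p x @ s @ replicate q x) =
    (-1) ^ q * int ((p + q) choose q) * Q s"
proof (induction "p + q" arbitrary: p q)
  case (Suc m)
  note step = ad_coeff_both_ends[OF assms, of "(ad_coeff x ^^ m) Q" p q]
  have eq: "(ad_coeff x ^^ (p + q)) Q = ad_coeff x ((ad_coeff x ^^ m) Q)"
    using Suc.hyps(2)[symmetric] by simp
  consider (a) p' where "p = Suc p'" "q = 0" | (b) q' where "p = 0" "q = Suc q'"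
    | (c) p' q' where "p = Suc p'" "q = Suc q'"
    using Suc.hyps(2) by (cases p; cases q) auto
  then show ?case
  proof cases
    case a
    then show ?thesis using step Suc.hyps(1)[of p' 0] Suc.hyps(2) by (simp add: eq)
  next
    case b
    then show ?thesis using step Suc.hyps(1)[of 0 q'] Suc.hyps(2) by (simp add: eq)
  next
    case c
    have l: "(ad_coeff x ^^ m) Q (replicate p' x @ s @ replicate q x) =
        (-1) ^ q * int ((p' + q) choose q) * Q s"
      using Suc.hyps(1)[of p' q] Suc.hyps(2) c by simp
    have r: "(ad_coeff x ^^ m) Q (replicate p x @ s @ replicate q' x) =
        (-1) ^ q' * int ((p + q') choose q') * Q s"
      using Suc.hyps(1)[of p q'] Suc.hyps(2) c by simp
    have "(ad_coeff x ^^ (p + q)) Q (replicate p x @ s @ replicate q x) =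
        (-1) ^ q * int ((p' + q) choose q) * Q s - (-1) ^ q' * int ((p + q') choose q') * Q s"
      unfolding eq step using l r c by simp
    also have "\<dots> = (-1) ^ q * int ((p + q) choose q) * Q s"
      using c by (simp add: algebra_simps)
    finally show ?thesis .
  qed
qed auto

text \<open>The \<open>m\<close> commutators with \<open>x\<close> remove only \<open>m\<close>
  letters, so an \<open>x\<close> is left at either end and the commutator with \<open>y\<close>
  finds no \<open>y\<close> to remove.\<close>

lemma ad_coeff_strip_zero:
  assumes "x \<noteq> y" "s \<noteq> []" "hd s = y" "last s = y" "i > m" "j > m"
  shows "(ad_coeff x ^^ m) (ad_coeff y Q) (replicate i x @ s @ replicate j x) = 0"
  using assms(5,6)
proof (induction m arbitrary: i j)
  case 0
  have "hd (replicate i x @ s @ replicate j x) = x" "last (replicate i x @ s @ replicate j x) = x"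
    using 0 by (auto simp: hd_append last_append)
  then show ?case using assms(1) by (auto simp: ad_coeff_def)
next
  case (Suc m)
  have "hd s \<noteq> x" "last s \<noteq> x" using assms by auto
  from ad_coeff_both_ends[OF assms(2) this] show ?case
    using Suc by simp
qed

text \<open>The right end keeps an \<open>x\<close>, so the \<open>y\<close> has to be removed on
  the left. This forces all \<open>m\<close> letters \<open>x\<close> to be removed on the left too,
  each time with sign \<open>+\<close>.\<close>

lemma ad_coeff_strip_left:
  assumes "x \<noteq> y" "s = y # u @ [y]" "j > m"
  shows "(ad_coeff x ^^ m) (ad_coeff y Q) (replicate m x @ s @ replicate j x) = Q (u @ [y] @ replicate j x)"
  using assms(3)
proof (induction m arbitrary: j)
  case 0
  have "last (s @ replicate j x) = x" using 0 by (auto simp: last_append)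
  then show ?case using assms(1,2) by (auto simp: ad_coeff_def)
next
  case (Suc m)
  have s: "s \<noteq> []" "hd s = y" "last s = y" using assms by auto
  then have "hd s \<noteq> x" "last s \<noteq> x" using assms by auto
  note step = ad_coeff_both_ends[OF s(1) this, of "(ad_coeff x ^^ m) (ad_coeff y Q)" "Suc m" j]
  have "(ad_coeff x ^^ m) (ad_coeff y Q) (replicate (Suc m) x @ s @ replicate (j - 1) x) = 0"
    using Suc.prems by (intro ad_coeff_strip_zero[OF assms(1) s]) auto
  moreover have "(ad_coeff x ^^ m) (ad_coeff y Q) (replicate m x @ s @ replicate j x) = Q (u @ [y] @ replicate j x)"
    using Suc.prems by (intro Suc.IH) auto
  ultimately show ?case
    using step by (simp del: replicate_Suc)
qed

section \<open>The word equation \<open>x^q y u = u y x^q\<close>\<close>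

lemma replicate_append_eqD:
  assumes "replicate m x @ y # u = replicate n x @ y # v" "x \<noteq> y"
  shows "m = n \<and> u = v"
proof -
  have "takeWhile (\<lambda>z. z = x) (replicate n x @ y # zs) = replicate n x" for n zs
    using assms(2) by (induction n) auto
  then have "replicate m x = replicate n x" by (metis assms(1))
  then have "m = n" by (metis length_replicate)
  then show ?thesis using assms(1) by simp
qed

text \<open>The solutions are \<open>u = (x^q y)^t x^q\<close>: one longer than \<open>q\<close>
  starts with \<open>x^q y\<close>, and removing this prefix leaves a shorter solution, while one of
  length at most \<open>q\<close> is \<open>x^q\<close>. Only the length is recorded.\<close>

lemma conjugate_length:
  assumes "x \<noteq> y" "replicate q x @ y # u = u @ y # replicate q x"
  shows "length u mod (q + 1) = q"
  using assms(2)
proof (induction "length u" arbitrary: u rule: less_induct)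
  case less
  let ?b = "replicate q x @ [y]"
  show ?case
  proof (cases "length u \<le> q")
    case True
    have "u = take (length u) (u @ y # replicate q x)" by simp
    also have "\<dots> = replicate (length u) x"
      unfolding less.prems[symmetric] using True by simp
    finally have u: "u = replicate (length u) x" .
    with less.prems have "replicate q x @ y # replicate (length u) x = replicate (length u) x @ y # replicate q x"
      by metis
    then have "q = length u" using replicate_append_eqD[OF _ assms(1)] by blast
    then show ?thesis by simp
  next
    case False
    have "take (q + 1) u = take (q + 1) (u @ y # replicate q x)" using False by simp
    also have "\<dots> = ?b" unfolding less.prems[symmetric] by simp
    finally obtain u' where u': "u = ?b @ u'" by (metis append_take_drop_id)
    then have "replicate q x @ y # u' = u' @ y # replicate q x" using less.prems by simp
    with less.hyps[of u'] u' have "length u' mod (q + 1) = q" by simp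
    moreover have "length u = (q + 1) + length u'" using u' by simp
    ultimately show ?thesis by (metis mod_add_self1)
  qed
qed

text \<open>Right-normed brackets of letters span the free Lie algebra, so this means that
  \<open>w\<close> occurs in some Lie polynomial.\<close>

definition in_lie_support :: "'a list \<Rightarrow> bool" where
  "in_lie_support w \<longleftrightarrow> (\<exists>xs. lie_coeff xs w \<noteq> 0)"

lemma in_lie_support_rev: "in_lie_support (rev w) \<longleftrightarrow> in_lie_support w"
  by (simp add: in_lie_support_def lie_coeff_rev)

lemma replicate_block_decomposition:
  assumes "y \<in> set w" "y \<noteq> x"
  obtains p s q where "w = replicate p x @ s @ replicate q x" "s \<noteq> []" "hd s \<noteq> x" "last s \<noteq> x"
proof -
  define v where "v = dropWhile (\<lambda>z. z = x) w"
  define s where "s = rev (dropWhile (\<lambda>z. z = x) (rev v))"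
  have tw: "takeWhile (\<lambda>z. z = x) l = replicate (length (takeWhile (\<lambda>z. z = x) l)) x" for l
    by (metis (mono_tags, lifting) replicate_length_same set_takeWhileD)
  obtain p where w: "w = replicate p x @ v"
    unfolding v_def by (metis takeWhile_dropWhile_id tw)
  obtain q where v: "v = s @ replicate q x"
    unfolding s_def by (metis rev_append rev_replicate rev_rev_ident takeWhile_dropWhile_id tw)
  have "y \<in> set s" using assms by (auto simp: w v)
  then have sne: "s \<noteq> []" by auto
  then have "v \<noteq> []" by (simp add: v)
  then have "hd v \<noteq> x" unfolding v_def by (rule hd_dropWhile)
  then have "hd s \<noteq> x" using sne by (simp add: v)
  moreover have "last s \<noteq> x"
    using sne hd_dropWhile[of "\<lambda>z. z = x" "rev v"] unfolding s_def by (simp add: last_rev)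
  ultimately show thesis using that[of p s q] w v sne by simp
qed

text \<open>
  Write \<open>w = x\<^sup>p s x\<^sup>q\<close> with \<open>s\<close> beginning and ending with the other letter \<open>y\<close>. Bracketing with \<open>p + q\<close>
  letters \<open>x\<close> reduces \<open>w\<close> to \<open>s\<close>; if \<open>s = yuy\<close> and \<open>p < q\<close>, bracketing with \<open>y\<close> and then \<open>p\<close> letters \<open>x\<close>
  reduces it to \<open>u y x\<^sup>q\<close>. These two words cannot both be palindromes of even length: otherwise \<open>u\<close>
  has even length, \<open>q\<close> is odd and \<open>x\<^sup>q y u = u y x\<^sup>q\<close>, contradicting \<open>conjugate_length\<close>.
\<close>

lemma in_lie_support_step:
  fixes w :: "bool list"
  assumes IH: "\<And>v :: bool list. length v < length w \<Longrightarrow> True \<in> set v \<Longrightarrow> False \<in> set v \<Longrightarrow>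
      \<not> (even (length v) \<and> rev v = v) \<Longrightarrow> in_lie_support v"
    and w: "w = replicate p x @ s @ replicate q x" "s \<noteq> []" "hd s \<noteq> x" "last s \<noteq> x"
    and pq: "p \<le> q" "q > 0"
    and np: "\<not> (even (length w) \<and> rev w = w)"
  shows "in_lie_support w"
proof -
  define y where "y = (\<not> x)"
  have xy: "x \<noteq> y" by (auto simp: y_def)
  have both: "True \<in> set v \<and> False \<in> set v" if "x \<in> set v" "y \<in> set v" for v
    using that unfolding y_def by (metis (full_types))
  have IH': "in_lie_support v"
    if "length v < length w" "x \<in> set v" "y \<in> set v" "\<not> (even (length v) \<and> rev v = v)" for v
    using IH[of v] both[of v] that by blast
  have hs: "hd s = y" "last s = y" using w by (auto simp: y_def)
  have strip: "in_lie_support w" if s: "in_lie_support s"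
  proof -
    from s obtain xs where xs: "lie_coeff xs s \<noteq> 0" by (auto simp: in_lie_support_def)
    then have "xs \<noteq> []" by auto
    then have "lie_coeff (replicate (p + q) x @ xs) w \<noteq> 0"
      using ad_coeff_strip[OF w(2-4), of p q "lie_coeff xs"] xs w(1) by (simp add: lie_coeff_replicate)
    then show ?thesis by (auto simp: in_lie_support_def)
  qed
  show ?thesis
  proof (cases "length s = 1")
    case True
    then have "s = [y]" using hs by (cases s) auto
    then have "lie_coeff [y] s \<noteq> 0" by simp
    then have "in_lie_support s" unfolding in_lie_support_def by blast
    then show ?thesis by (rule strip)
  next
    case False
    with w(2) hs obtain u where s: "s = y # u @ [y]"
      by (cases s; cases "tl s" rule: rev_cases) auto
    have left: "in_lie_support w" if lt: "p < q" and v: "in_lie_support (u @ [y] @ replicate q x)"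
    proof -
      from v obtain xs where xs: "lie_coeff xs (u @ [y] @ replicate q x) \<noteq> 0"
        by (auto simp: in_lie_support_def)
      then have "xs \<noteq> []" by auto
      then have "lie_coeff (replicate p x @ y # xs) w \<noteq> 0"
        using ad_coeff_strip_left[OF xy s lt, of "lie_coeff xs"] xs w(1)
        by (simp add: lie_coeff_replicate lie_coeff_Cons)
      then show ?thesis by (auto simp: in_lie_support_def)
    qed
    have ysuf: "in_lie_support (u @ [y] @ replicate q x)"
      if "\<not> (even (length (u @ [y] @ replicate q x)) \<and> rev (u @ [y] @ replicate q x) = u @ [y] @ replicate q x)"
      by (rule IH') (use that pq w(1) s in auto)
    show ?thesis
    proof (cases "x \<in> set s")
      case xs: True
      show ?thesis
      proof (cases "even (length s) \<and> rev s = s")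
        case False
        have "length s < length w" using w(1) pq by simp
        from IH'[OF this xs _ False] s strip show ?thesis by simp
      next
        case True
        have "p < q"
        proof (rule ccontr)
          assume "\<not> p < q"
          then have "p = q" using pq by simp
          then show False using np w(1) True by simp
        qed
        moreover have "\<not> (even (length (u @ [y] @ replicate q x)) \<and>
          rev (u @ [y] @ replicate q x) = u @ [y] @ replicate q x)"
        proof
          assume *: "even (length (u @ [y] @ replicate q x)) \<and>
            rev (u @ [y] @ replicate q x) = u @ [y] @ replicate q x"
          have u: "rev u = u" "even (length u)" using True s by auto
          with * have "replicate q x @ y # u = u @ y # replicate q x" by simp
          from conjugate_length[OF xy this] have "length u mod (q + 1) = q" .
          moreover have "even (q + 1)" using * u by simp
          ultimately have "odd (length u)"
            by (metis dvd_mod_iff even_plus_one_iff)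
          then show False using u by simp
        qed
        ultimately show ?thesis using left ysuf by blast
      qed
    next
      \<comment> \<open>Here \<open>s\<close> is a power of \<open>y\<close>, and the induction
        hypothesis says nothing about it. For \<open>p < q\<close> the other reduction works:
        \<open>u y x^q\<close> begins with \<open>y\<close> and ends with \<open>x\<close>, so it is
        no palindrome.\<close>
      case False
      have all_y: "z = y" if "z \<in> set s" for z
      proof -
        have "z \<noteq> x" using that False by blast
        then show ?thesis unfolding y_def by blast
      qed
      then have sy: "s = replicate (length s) y"
        by (intro replicate_length_same[symmetric] ballI)
      have rev_s: "rev s = s"
        by (subst (1 2) sy) simp
      show ?thesis
      proof (cases "p < q")
        case True
        have "hd (u @ [y] @ replicate q x) = y"
        proof (cases u)
          case (Cons a l)
          then have "a \<in> set s" using s by auto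
          then have "a = y" by (rule all_y)
          then show ?thesis using Cons by simp
        qed simp
        moreover have "last (u @ [y] @ replicate q x) = x" using pq by (simp add: last_append)
        ultimately have "rev (u @ [y] @ replicate q x) \<noteq> u @ [y] @ replicate q x"
          using xy by (metis hd_rev)
        then show ?thesis using left[OF True] ysuf by blast
      next
        \<comment> \<open>Now \<open>w\<close> is a palindrome, hence of odd length. Without its
          last letter it is shorter and no longer a palindrome, so the induction hypothesis applies
          to that word.\<close>
        case False
        then have pq': "p = q" using pq by simp
        then have pal: "rev w = w" using w(1) rev_s by simp
        then have odd: "odd (length w)" using np by simp
        have wne: "w \<noteq> []" using w by simp
        have hw: "hd w = x" "last w = x" using w(1) pq pq' by (auto simp: hd_append last_append)
        obtain q' where q': "q = Suc q'" using pq by (cases q) auto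
        have bl: "butlast w = replicate p x @ s @ replicate q' x"
          using w(1) q' by (simp add: butlast_append flip: replicate_append_same)
        have "rev (butlast w) \<noteq> butlast w"
        proof
          assume "rev (butlast w) = butlast w"
          then have "replicate q' x @ s @ replicate p x = replicate p x @ s @ replicate q' x"
            using bl rev_s by simp
          then have "(replicate q' x @ s @ replicate p x) ! q' = (replicate p x @ s @ replicate q' x) ! q'"
            by simp
          moreover have "(replicate q' x @ s @ replicate p x) ! q' = y"
            using w(2) hs(1) by (simp add: nth_append hd_conv_nth)
          moreover have "(replicate p x @ s @ replicate q' x) ! q' = x"
            using pq' q' by (simp add: nth_append del: replicate_Suc)
          ultimately have "y = x" by simp
          then show False using xy by simp
        qed
        moreover have "length (butlast w) < length w" using wne by simp
        moreover have "x \<in> set (butlast w)" "y \<in> set (butlast w)"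
          unfolding bl using pq pq' s by auto
        ultimately have "in_lie_support (butlast w)" using IH'[of "butlast w"] by blast
        then obtain xs where xs: "lie_coeff xs (butlast w) \<noteq> 0" by (auto simp: in_lie_support_def)
        then have xsne: "xs \<noteq> []" by auto
        have "length (butlast w) = length xs" using xs by (rule lie_coeff_length)
        then have "even (length xs)" using odd by (cases "length w") auto
        moreover have "tl w = rev (butlast w)" using pal by (metis tl_rev)
        \<comment> \<open>The two ends of \<open>w\<close> give a word of even length and its
          reverse, whose coefficients are opposite; so the commutator doubles them instead of
          cancelling.\<close>
        ultimately have "lie_coeff (x # xs) w = - 2 * lie_coeff xs (butlast w)"
          using xsne wne hw by (simp add: lie_coeff_Cons ad_coeff_def lie_coeff_rev)
        then show ?thesis using xs unfolding in_lie_support_def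
          by (metis mult_eq_0_iff neg_equal_0_iff_equal zero_neq_numeral)
      qed
    qed
  qed
qed

text \<open>The existence half of the Duchamp-Thibon theorem, by induction on the length. Reversal
  exchanges \<open>p\<close> and \<open>q\<close>, which reduces to the case where the left power is
  the shorter one.\<close>

lemma in_lie_support_if_not_even_palindrome:
  fixes w :: "bool list"
  assumes "True \<in> set w" "False \<in> set w" "\<not> (even (length w) \<and> rev w = w)"
  shows "in_lie_support w"
  using assms
proof (induction "length w" arbitrary: w rule: less_induct)
  case less
  \<comment> \<open>Taking the last letter as \<open>x\<close> ensures \<open>q > 0\<close>.\<close>
  define x where "x = last w"
  have "(\<not> x) \<in> set w" using less.prems by (cases x) simp_all
  then obtain p s q where w: "w = replicate p x @ s @ replicate q x" "s \<noteq> []" "hd s \<noteq> x" "last s \<noteq> x"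
    by (rule replicate_block_decomposition[of "\<not> x" w x]) auto
  have q: "q > 0" using w x_def by (cases q) auto
  show ?case
  proof (cases "p \<le> q")
    case True
    show ?thesis
      by (rule in_lie_support_step[OF _ w True q less.prems(3)]) (use less.hyps in blast)
  next
    case False
    have "in_lie_support (rev w)"
    proof (rule in_lie_support_step[of "rev w" q x "rev s" p])
      show "in_lie_support v" if "length v < length (rev w)" "True \<in> set v" "False \<in> set v"
        "\<not> (even (length v) \<and> rev v = v)" for v
        using that less.hyps[of v] by simp
    qed (use w False less.prems(3) in \<open>auto simp: hd_rev last_rev\<close>)
    then show ?thesis by (simp add: in_lie_support_rev)
  qed
qed

section \<open>The superdiagonal word\<close>

text \<open>In words, \<open>True\<close> stands for \<open>E\<close> and \<open>False\<close> for \<open>D\<close>.\<close>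

fun comp_word :: "nat list \<Rightarrow> bool list" where
  "comp_word [] = []"
| "comp_word [a] = replicate (a - 1) False"
| "comp_word (a # b # as) = replicate (a - 1) False @ True # comp_word (b # as)"

lemma comp_word_Cons: "as \<noteq> [] \<Longrightarrow> comp_word (a # as) = replicate (a - 1) False @ True # comp_word as"
  by (cases as) auto

lemma comp_word_snoc: "as \<noteq> [] \<Longrightarrow> comp_word (as @ [a]) = comp_word as @ True # replicate (a - 1) False"
  by (induction as rule: comp_word.induct) auto

lemma rev_comp_word: "rev (comp_word as) = comp_word (rev as)"
proof (induction as rule: comp_word.induct)
  case (3 a b as)
  then show ?case using comp_word_snoc[of "rev (b # as)" a] by simp
qed auto

lemma length_comp_word:
  "as \<noteq> [] \<Longrightarrow> \<forall>a\<in>set as. a > 0 \<Longrightarrow> Suc (length (comp_word as)) = sum_list as"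
  by (induction as rule: comp_word.induct) auto

lemma count_comp_word: "as \<noteq> [] \<Longrightarrow> count_list (comp_word as) True = length as - 1"
  by (induction as rule: comp_word.induct) auto

text \<open>The parts of a composition are recovered from the runs of \<open>False\<close>.
  Positivity matters because \<open>a - 1\<close> is cut off at 0 and would not tell the parts 0 and
  1 apart.\<close>

lemma comp_word_inj:
  assumes "comp_word as = comp_word bs" "as \<noteq> []" "bs \<noteq> []"
    "\<forall>a\<in>set as. a > 0" "\<forall>b\<in>set bs. b > 0"
  shows "as = bs"
  using assms
proof (induction as arbitrary: bs rule: comp_word.induct)
  case (2 a)
  then show ?case
  proof (cases bs rule: comp_word.cases)
    case (3 b c cs)
    then have "True \<in> set (replicate (a - 1) False)" using 2(1) by simp
    then show ?thesis by simp
  next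
    case (2 b)
    then have "a - 1 = b - 1" using "2.prems"(1) by (metis comp_word.simps(2) length_replicate)
    then show ?thesis using 2 "2.prems" by simp
  qed simp
next
  case (3 a b as)
  from 3(4) show ?case
  proof (cases bs rule: comp_word.cases)
    case (2 c)
    then have "True \<in> set (replicate (c - 1) False)" using 3(2)[symmetric] by simp
    then show ?thesis by simp
  next
    case (3 c e cs)
    have "replicate (a - 1) False @ True # comp_word (b # as) = replicate (c - 1) False @ True # comp_word (e # cs)"
      using "3.prems"(1) 3 by simp
    from replicate_append_eqD[OF this] have "a - 1 = c - 1" "comp_word (b # as) = comp_word (e # cs)" by auto
    moreover have "b # as = e # cs"
      using "3.IH"[of "e # cs"] "3.prems" 3 calculation by simp
    moreover have "a > 0" "c > 0" using 3 "3.prems"(4,5) by simp_all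
    then have "a = c" using \<open>a - 1 = c - 1\<close> by linarith
    ultimately show ?thesis using 3 by simp
  qed simp
qed simp

lemma comp_word_no_False:
  assumes "\<forall>a\<in>set as. a > 0" "False \<notin> set (comp_word as)"
  shows "\<forall>a\<in>set as. a = 1"
  using assms
proof (induction as rule: comp_word.induct)
  case (2 a)
  then show ?case by (cases "a - 1") auto
next
  case (3 a b as)
  then show ?case by (cases "a - 1") auto
qed simp

text \<open>The positions of the letter \<open>z\<close> in \<open>w\<close>, marked on the
  superdiagonal. For the two letters together these matrices add up to a single nilpotent Jordan
  block.\<close>

definition letter_mat :: "bool list \<Rightarrow> bool \<Rightarrow> 'a::field mat" where
  "letter_mat w z = mat (Suc (length w)) (Suc (length w)) (\<lambda>(r, c). of_bool (c = Suc r \<and> w ! r = z))"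

text \<open>The superdiagonal of a direct sum of Jordan blocks is 0 exactly between consecutive
  blocks, and there \<open>comp_word\<close> has the letter \<open>True\<close>.\<close>

lemma jordan_matrix_letter_mat:
  assumes "as \<noteq> []" "\<forall>a\<in>set as. a > 0"
  shows "jordan_matrix (map (\<lambda>a. (a, 0)) as) = (letter_mat (comp_word as) False :: 'a::field mat)"
  using assms
proof (induction as rule: comp_word.induct)
  case (2 a)
  show ?case
    by (rule eq_matI) (use 2 in \<open>auto simp: jordan_matrix_def letter_mat_def\<close>)
next
  case (3 a b as)
  let ?B = "letter_mat (comp_word (b # as)) False :: 'a mat"
  have "jordan_matrix (map (\<lambda>a. (a, 0)) (a # b # as)) =
      four_block_mat (jordan_block a 0) (0\<^sub>m a (dim_col ?B)) (0\<^sub>m (dim_row ?B) a) ?B"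
    using 3 by (simp add: jordan_matrix_def Let_def)
  also have "\<dots> = letter_mat (comp_word (a # b # as)) False"
  proof (rule eq_matI)
    fix r c
    assume "r < dim_row (letter_mat (comp_word (a # b # as)) False :: 'a mat)"
      "c < dim_col (letter_mat (comp_word (a # b # as)) False :: 'a mat)"
    then have rc: "r < a + Suc (length (comp_word (b # as)))" "c < a + Suc (length (comp_word (b # as)))"
      using 3(3) by (auto simp: letter_mat_def)
    have "c \<le> r" if "\<not> Suc r < a" "c < a" using that by simp
    then show "four_block_mat (jordan_block a 0) (0\<^sub>m a (dim_col ?B)) (0\<^sub>m (dim_row ?B) a) ?B $$ (r, c) =
        letter_mat (comp_word (a # b # as)) False $$ (r, c)"
      using rc 3(3) by (auto simp: letter_mat_def nth_append nth_Cons')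
  qed (use 3 in \<open>auto simp: letter_mat_def\<close>)
  finally show ?case .
qed simp

section \<open>The word of a sequence \<open>d\<close>\<close>

definition block_word :: "nat \<Rightarrow> (nat \<Rightarrow> nat) \<Rightarrow> bool list" where
  "block_word k d = comp_word (map d [1..<k + 1])"

lemma total_size_sum_list: "total_size k d = sum_list (map d [1..<k + 1])"
  by (simp add: total_size_def sum_list_distinct_conv_sum_set atLeastLessThanSuc_atLeastAtMost del: upt_Suc)

lemma total_size_offset: "total_size k d = offset d (Suc k)"
  by (simp add: total_size_def offset_def atLeastLessThanSuc_atLeastAtMost)

lemma offset_Suc: "i \<ge> 1 \<Longrightarrow> offset d (Suc i) = offset d i + d i"
  by (simp add: offset_def)

lemma offset_mono: "i \<le> j \<Longrightarrow> offset d i \<le> offset d j"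
  unfolding offset_def by (rule sum_mono2) auto

lemma length_block_word:
  assumes "k \<ge> 1" "\<forall>i\<in>{1..k}. d i > 0"
  shows "Suc (length (block_word k d)) = total_size k d"
  unfolding block_word_def total_size_sum_list
  by (rule length_comp_word) (use assms in auto)

lemma count_block_word: "k \<ge> 1 \<Longrightarrow> count_list (block_word k d) True = k - 1"
  unfolding block_word_def by (subst count_comp_word) (auto simp del: upt_Suc)

lemma block_word_Suc:
  "k \<ge> 1 \<Longrightarrow> block_word (Suc k) d = block_word k d @ True # replicate (d (Suc k) - 1) False"
  using comp_word_snoc[of "map d [1..<k + 1]" "d (Suc k)"] by (simp add: block_word_def)

text \<open>The last row of block \<open>i\<close> is \<open>offset d (Suc i) - 1\<close>; in these
  rows the superdiagonal crosses into the next block, which is where \<open>E\<close> has its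
  entries.\<close>

lemma block_word_nth:
  assumes "k \<ge> 1" "\<forall>i\<in>{1..k}. d i > 0" "r < length (block_word k d)"
  shows "block_word k d ! r \<longleftrightarrow> (\<exists>i\<in>{1..<k}. Suc r = offset d (Suc i))"
  using assms
proof (induction k rule: dec_induct)
  case base
  then show ?case by (simp add: block_word_def)
next
  case (step k)
  have len: "Suc (length (block_word k d)) = offset d (Suc k)"
    using step length_block_word[of k d] by (simp add: total_size_offset)
  have ivl: "{1..<Suc k} = insert k {1..<k}" using step by auto
  consider "r < length (block_word k d)" | "r = length (block_word k d)" | "r > length (block_word k d)"
    by linarith
  then show ?case
  proof cases
    case 1
    then show ?thesis using step len unfolding ivl by (auto simp: block_word_Suc nth_append)
  next
    case 2
    then show ?thesis using step len unfolding ivl by (auto simp: block_word_Suc nth_append)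
  next
    case 3
    have "offset d (Suc i) \<le> offset d (Suc k)" if "i \<in> {1..<Suc k}" for i
      using that by (intro offset_mono) auto
    then have "\<not> (\<exists>i\<in>{1..<Suc k}. Suc r = offset d (Suc i))"
      using 3 len by fastforce
    moreover have "\<not> block_word (Suc k) d ! r"
      using 3 step by (simp add: block_word_Suc nth_append nth_Cons')
    ultimately show ?thesis by simp
  qed
qed

lemma D_mat_letter_mat:
  assumes "k \<ge> 1" "\<forall>i\<in>{1..k}. d i > 0"
  shows "D_mat k d = (letter_mat (block_word k d) False :: 'a::field mat)"
proof -
  have "D_mat k d = (jordan_matrix (map (\<lambda>a. (a, 0)) (map d [1..<k + 1])) :: 'a mat)"
    by (simp add: D_mat_def comp_def)
  also have "\<dots> = letter_mat (block_word k d) False"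
    unfolding block_word_def by (rule jordan_matrix_letter_mat) (use assms in auto)
  finally show ?thesis .
qed

lemma offset_inj:
  assumes "\<forall>i\<in>{1..k}. d i > 0" "i \<in> {1..k}" "j \<in> {1..k}" "offset d (Suc i) = offset d (Suc j)"
  shows "i = j"
proof -
  have "offset d (Suc a) < offset d (Suc b)" if "a \<in> {1..k}" "b \<in> {1..k}" "a < b" for a b
  proof -
    have "offset d (Suc a) \<le> offset d b" using that by (intro offset_mono) auto
    also have "\<dots> < offset d (Suc b)" using that assms(1) by (subst offset_Suc) auto
    finally show ?thesis .
  qed
  then show ?thesis using assms(2-4) by (metis less_irrefl linorder_neqE_nat)
qed

lemma E_mat_letter_mat:
  assumes "k \<ge> 1" "\<forall>i\<in>{1..k}. d i > 0"
  shows "E_mat k d = (letter_mat (block_word k d) True :: 'a::field mat)"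
proof (rule eq_matI)
  have len: "Suc (length (block_word k d)) = total_size k d" by (rule length_block_word[OF assms])
  then show "dim_row (E_mat k d :: 'a mat) = dim_row (letter_mat (block_word k d) True :: 'a mat)"
    "dim_col (E_mat k d :: 'a mat) = dim_col (letter_mat (block_word k d) True :: 'a mat)"
    by (simp_all add: E_mat_def superdiag_mat_def letter_mat_def)
  fix r c
  assume "r < dim_row (letter_mat (block_word k d) True :: 'a mat)"
    "c < dim_col (letter_mat (block_word k d) True :: 'a mat)"
  then have rc: "r < total_size k d" "c < total_size k d"
    using len by (auto simp: letter_mat_def)
  \<comment> \<open>The single 1 of \<open>canonical_seq d i\<close>, at the lower left of its
    block, has global row \<open>offset d (Suc i) - 1\<close> and global column
    \<open>offset d (Suc i)\<close>.\<close>
  have entry: "(if r \<in> block_range d i \<and> c \<in> block_range d (i + 1)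
      then canonical_seq d i $$ (r - offset d i, c - offset d (i + 1)) else 0)
      = (of_bool (Suc r = offset d (Suc i) \<and> c = Suc r) :: 'a)" if i: "i \<in> {1..<k}" for i
  proof -
    have "d i > 0" "d (Suc i) > 0" "offset d (Suc i) = offset d i + d i"
      using i assms by (auto simp: offset_Suc)
    then show ?thesis
      by (auto simp: block_range_def canonical_seq_def split: if_splits)
  qed
  have "(E_mat k d :: 'a mat) $$ (r, c) = (\<Sum>i\<in>{1..<k}. if r \<in> block_range d i \<and> c \<in> block_range d (i + 1)
      then canonical_seq d i $$ (r - offset d i, c - offset d (i + 1)) else 0)"
    using rc by (simp add: E_mat_def superdiag_mat_def)
  also have "\<dots> = (\<Sum>i\<in>{1..<k}. of_bool (Suc r = offset d (Suc i) \<and> c = Suc r))"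
    using entry by (rule sum.cong[OF refl])
  also have "\<dots> = of_bool (c = Suc r \<and> block_word k d ! r)"
  proof (cases "c = Suc r \<and> (\<exists>i\<in>{1..<k}. Suc r = offset d (Suc i))")
    case True
    then obtain i where i: "i \<in> {1..<k}" "Suc r = offset d (Suc i)" "c = Suc r" by auto
    have "of_bool (Suc r = offset d (Suc j) \<and> c = Suc r) = (if j = i then 1 else (0 :: 'a))"
      if j: "j \<in> {1..<k}" for j
    proof (cases "j = i")
      case False
      then have "offset d (Suc j) \<noteq> offset d (Suc i)"
        using offset_inj[OF assms(2), of j i] i(1) j by auto
      then show ?thesis using False i(2) by simp
    qed (use i in simp)
    then have "(\<Sum>j\<in>{1..<k}. of_bool (Suc r = offset d (Suc j) \<and> c = Suc r)) =
        (\<Sum>j\<in>{1..<k}. if j = i then 1 else (0 :: 'a))"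
      by (rule sum.cong[OF refl])
    moreover have "r < length (block_word k d)" using i(3) rc len by simp
    ultimately show ?thesis using i block_word_nth[OF assms] by auto
  next
    case False
    then have "(\<Sum>j\<in>{1..<k}. of_bool (Suc r = offset d (Suc j) \<and> c = Suc r)) = (0 :: 'a)"
      by (intro sum.neutral) auto
    moreover have "r < length (block_word k d)" if "c = Suc r" using that rc len by simp
    ultimately show ?thesis using False block_word_nth[OF assms] by auto
  qed
  also have "\<dots> = letter_mat (block_word k d) True $$ (r, c)"
    using rc len by (simp add: letter_mat_def)
  finally show "(E_mat k d :: 'a mat) $$ (r, c) = letter_mat (block_word k d) True $$ (r, c)" .
qed

section \<open>Matrix Lie algebras and ranks\<close>

lemma mat_bracket_carrier [simp]:
  "X \<in> carrier_mat n n \<Longrightarrow> Y \<in> carrier_mat n n \<Longrightarrow> mat_bracket X Y \<in> carrier_mat n n"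
  by (auto simp: mat_bracket_def)

lemma mat_bracket_index:
  assumes "X \<in> carrier_mat n n" "Y \<in> carrier_mat n n" "r < n" "c < n"
  shows "mat_bracket X Y $$ (r, c) = (\<Sum>l<n. X $$ (r, l) * Y $$ (l, c)) - (\<Sum>l<n. Y $$ (r, l) * X $$ (l, c))"
  using assms by (auto simp: mat_bracket_def scalar_prod_def atLeast0LessThan)

lemma mat_bracket_add:
  assumes "X \<in> carrier_mat n n" "Y \<in> carrier_mat n n" "Z \<in> carrier_mat n n"
  shows "mat_bracket Z (X + Y) = mat_bracket Z X + mat_bracket Z Y"
  unfolding mat_bracket_def
  using assms by (intro eq_matI) (auto simp: mult_add_distrib_mat[of _ n n] add_mult_distrib_mat[of _ n n])

lemma mat_bracket_smult:
  assumes "X \<in> carrier_mat n n" "Z \<in> carrier_mat n n"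
  shows "mat_bracket Z (a \<cdot>\<^sub>m X) = a \<cdot>\<^sub>m mat_bracket Z (X :: 'a::comm_ring_1 mat)"
  unfolding mat_bracket_def
  using assms by (intro eq_matI) (auto simp: algebra_simps)

lemma mat_bracket_zero_right: "X \<in> carrier_mat n n \<Longrightarrow> mat_bracket X (0\<^sub>m n n) = 0\<^sub>m n n"
  by (simp add: mat_bracket_def)

lemma mat_bracket_self: "X \<in> carrier_mat n n \<Longrightarrow> mat_bracket X X = 0\<^sub>m n n"
  by (simp add: mat_bracket_def)

lemma mat_bracket_swap:
  "X \<in> carrier_mat n n \<Longrightarrow> Y \<in> carrier_mat n n \<Longrightarrow> mat_bracket X Y = (-1) \<cdot>\<^sub>m mat_bracket Y (X :: 'a::comm_ring_1 mat)"
  unfolding mat_bracket_def by (rule eq_matI) auto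

text \<open>The Jacobi identity, in the form that \<open>ad Z\<close> is a derivation.\<close>

lemma mat_bracket_jacobi:
  assumes "X \<in> carrier_mat n n" "Y \<in> carrier_mat n n" "Z \<in> carrier_mat n n"
  shows "mat_bracket Z (mat_bracket X Y) =
    mat_bracket (mat_bracket Z X) Y + mat_bracket X (mat_bracket Z (Y :: 'a::comm_ring_1 mat))"
proof -
  have [simp]: "X * Y \<in> carrier_mat n n" "Y * X \<in> carrier_mat n n" "Z * X \<in> carrier_mat n n"
    "X * Z \<in> carrier_mat n n" "Z * Y \<in> carrier_mat n n" "Y * Z \<in> carrier_mat n n"
    using assms by auto
  show ?thesis
    unfolding mat_bracket_def
    using assms
    by (intro eq_matI)
      (auto simp: mult_minus_distrib_mat[of _ n n _ n] minus_mult_distrib_mat[of _ n n _ _ n]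
        assoc_mult_mat[of _ n n _ n _ n])
qed

lemma smult_smult_mat: "a \<cdot>\<^sub>m (b \<cdot>\<^sub>m A) = (a * b) \<cdot>\<^sub>m (A :: 'a::semigroup_mult mat)"
  by (rule eq_matI) (auto simp: mult.assoc)

lemma smult_mat_eq_zeroD:
  assumes "a \<cdot>\<^sub>m A = 0\<^sub>m n m" "A \<noteq> 0\<^sub>m n m"
  shows "a = (0 :: 'a::field)"
proof (rule ccontr)
  assume "a \<noteq> 0"
  then have "A = inverse a \<cdot>\<^sub>m (a \<cdot>\<^sub>m A)" unfolding smult_smult_mat by (intro eq_matI) auto
  also have "\<dots> = 0\<^sub>m n m" unfolding assms(1) by (intro eq_matI) auto
  finally show False using assms(2) by contradiction
qed

lemma mat_bracket_multiples:
  assumes "E \<in> carrier_mat n n"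
  shows "mat_bracket (a \<cdot>\<^sub>m E) (b \<cdot>\<^sub>m E) = (0\<^sub>m n n :: 'a::field mat)"
proof -
  have aE: "a \<cdot>\<^sub>m E \<in> carrier_mat n n" using assms by simp
  have "mat_bracket (a \<cdot>\<^sub>m E) (b \<cdot>\<^sub>m E) = b \<cdot>\<^sub>m ((-1) \<cdot>\<^sub>m (a \<cdot>\<^sub>m mat_bracket E E))"
    unfolding mat_bracket_smult[OF assms aE] mat_bracket_swap[OF aE assms] mat_bracket_smult[OF assms assms] ..
  also have "\<dots> = 0\<^sub>m n n" unfolding mat_bracket_self[OF assms] by (intro eq_matI) auto
  finally show ?thesis .
qed

section \<open>Subspaces, spans and generated Lie algebras\<close>

definition mat_subspace :: "nat \<Rightarrow> 'a::field mat set \<Rightarrow> bool" where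
  "mat_subspace n L \<longleftrightarrow> L \<subseteq> carrier_mat n n \<and> 0\<^sub>m n n \<in> L \<and>
    (\<forall>X\<in>L. \<forall>Y\<in>L. X + Y \<in> L) \<and> (\<forall>a. \<forall>X\<in>L. a \<cdot>\<^sub>m X \<in> L)"

lemma subspace_iff_mat_subspace:
  "VectorSpace.subspace class_ring L (module_mat TYPE('a::field) n n) \<longleftrightarrow> mat_subspace n L"
proof -
  have vs: "vectorspace (class_ring :: 'a ring) (module_mat TYPE('a) n n)"
    by (rule matrix_vs)
  then have "module (class_ring :: 'a ring) (module_mat TYPE('a) n n)"
    by (simp add: vectorspace_def)
  then show ?thesis
    using vs by (auto simp: VectorSpace.subspace_def LinearCombinations.submodule_def mat_subspace_def
        module_mat_simps class_ring_simps)
qed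

abbreviation mat_span :: "nat \<Rightarrow> 'a::field mat set \<Rightarrow> 'a mat set" where
  "mat_span n S \<equiv> LinearCombinations.module.span class_ring (module_mat TYPE('a) n n) S"

lemma mat_span_subspace: "S \<subseteq> carrier_mat n n \<Longrightarrow> mat_subspace n (mat_span n (S :: 'a::field mat set))"
  using vectorspace.span_is_subspace[OF matrix_vs, of S n n]
  by (simp add: subspace_iff_mat_subspace module_mat_simps)

lemma mat_span_superset: "S \<subseteq> carrier_mat n n \<Longrightarrow> S \<subseteq> mat_span n (S :: 'a::field mat set)"
  using module.in_own_span[OF vectorspace.axioms(1)[OF matrix_vs], of S n n]
  by (simp add: module_mat_simps)

lemma mat_span_least:
  assumes "S \<subseteq> L" "mat_subspace n L"
  shows "mat_span n (S :: 'a::field mat set) \<subseteq> L"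
proof -
  have "submodule class_ring L (module_mat TYPE('a) n n)"
    using assms(2) by (simp add: VectorSpace.subspace_def flip: subspace_iff_mat_subspace)
  then show ?thesis
    using module.span_is_subset[OF vectorspace.axioms(1)[OF matrix_vs] assms(1)] by blast
qed

lemma lie_subalgebra_iff:
  "lie_subalgebra n L \<longleftrightarrow> mat_subspace n L \<and> (\<forall>X\<in>L. \<forall>Y\<in>L. mat_bracket X Y \<in> L)"
  by (simp add: lie_subalgebra_def subspace_iff_mat_subspace)

lemma mat_subspace_D:
  assumes "mat_subspace n L"
  shows "L \<subseteq> carrier_mat n n" "0\<^sub>m n n \<in> L" "\<And>X Y. X \<in> L \<Longrightarrow> Y \<in> L \<Longrightarrow> X + Y \<in> L"
    "\<And>a X. X \<in> L \<Longrightarrow> a \<cdot>\<^sub>m X \<in> L"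
  using assms by (auto simp: mat_subspace_def)

lemma lie_subalgebra_carrier: "lie_subalgebra n (carrier_mat n n)"
  by (auto simp: lie_subalgebra_iff mat_subspace_def)

lemma lie_generated_subalgebra:
  assumes "S \<subseteq> carrier_mat n n"
  shows "lie_subalgebra n (lie_generated n S)"
  using assms lie_subalgebra_carrier[of n]
  unfolding lie_generated_def hull_def
  by (fastforce simp: lie_subalgebra_iff mat_subspace_def)

lemma lie_generated_superset: "S \<subseteq> lie_generated n S"
  unfolding lie_generated_def by (rule hull_subset)

lemma lie_generated_least: "S \<subseteq> L \<Longrightarrow> lie_subalgebra n L \<Longrightarrow> lie_generated n S \<subseteq> L"
  unfolding lie_generated_def by (rule hull_minimal)

text \<open>Because \<open>ad Z\<close> is a derivation, the elements of the generated algebra that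
  it maps back into this algebra form a subalgebra, and that contains the generators. It serves for
  \<open>Z = D\<close> acting on the algebra generated by the \<open>(ad D)^l E\<close>.\<close>

lemma lie_generated_bracket_closed:
  fixes Z :: "'a::field mat"
  assumes "S \<subseteq> carrier_mat n n" "Z \<in> carrier_mat n n" "\<And>X. X \<in> S \<Longrightarrow> mat_bracket Z X \<in> lie_generated n S"
    "X \<in> lie_generated n S"
  shows "mat_bracket Z X \<in> lie_generated n S"
proof -
  let ?L = "lie_generated n S"
  have L: "lie_subalgebra n ?L" by (rule lie_generated_subalgebra[OF assms(1)])
  then have sub: "mat_subspace n ?L" and br: "\<And>X Y. X \<in> ?L \<Longrightarrow> Y \<in> ?L \<Longrightarrow> mat_bracket X Y \<in> ?L"
    by (auto simp: lie_subalgebra_iff)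
  note D = mat_subspace_D[OF sub]
  have "lie_subalgebra n {X \<in> ?L. mat_bracket Z X \<in> ?L}"
    unfolding lie_subalgebra_iff mat_subspace_def
  proof (intro conjI ballI allI subsetI CollectI)
    fix X Y assume XY: "X \<in> {X \<in> ?L. mat_bracket Z X \<in> ?L}" "Y \<in> {X \<in> ?L. mat_bracket Z X \<in> ?L}"
    then have c: "X \<in> carrier_mat n n" "Y \<in> carrier_mat n n" using D(1) by auto
    show "X + Y \<in> ?L" "mat_bracket X Y \<in> ?L" using XY D br by auto
    have "mat_bracket Z X + mat_bracket Z Y \<in> ?L" using XY by (auto intro: D(3))
    then show "mat_bracket Z (X + Y) \<in> ?L" by (simp only: mat_bracket_add[OF c assms(2)])
    have "mat_bracket (mat_bracket Z X) Y + mat_bracket X (mat_bracket Z Y) \<in> ?L"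
      using XY by (auto intro: D(3) br)
    then show "mat_bracket Z (mat_bracket X Y) \<in> ?L"
      by (simp only: mat_bracket_jacobi[OF c assms(2)])
  next
    fix a X assume X: "X \<in> {X \<in> ?L. mat_bracket Z X \<in> ?L}"
    then have c: "X \<in> carrier_mat n n" using D(1) by auto
    show "a \<cdot>\<^sub>m X \<in> ?L" using X by (auto intro: D(4))
    have "a \<cdot>\<^sub>m mat_bracket Z X \<in> ?L" using X by (auto intro: D(4))
    then show "mat_bracket Z (a \<cdot>\<^sub>m X) \<in> ?L" by (simp only: mat_bracket_smult[OF c assms(2)])
  next
    show "mat_bracket Z (0\<^sub>m n n) \<in> ?L" using D(2) by (simp only: mat_bracket_zero_right[OF assms(2)])
  qed (use D(1,2) in auto)
  then have "?L \<subseteq> {X \<in> ?L. mat_bracket Z X \<in> ?L}"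
    using assms(3) lie_generated_superset by (intro lie_generated_least) auto
  then show ?thesis using assms(4) by auto
qed

section \<open>The lower central series\<close>

lemma lower_central_subspace:
  assumes "lie_subalgebra n L"
  shows "mat_subspace n (lower_central n L i) \<and> lower_central n L i \<subseteq> L"
proof (induction i)
  case 0
  then show ?case using assms by (simp add: lie_subalgebra_iff)
next
  case (Suc i)
  let ?S = "{mat_bracket X Y |X Y. X \<in> L \<and> Y \<in> lower_central n L i}"
  have S: "?S \<subseteq> L" using Suc assms by (auto simp: lie_subalgebra_iff)
  moreover have "L \<subseteq> carrier_mat n n" using assms by (auto simp: lie_subalgebra_iff mat_subspace_def)
  ultimately show ?case
    using mat_span_subspace[of ?S n] mat_span_least[OF S] assms by (auto simp: lie_subalgebra_iff)
qed

lemma mat_bracket_in_lower_central: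
  assumes "lie_subalgebra n L" "X \<in> L" "Y \<in> lower_central n L i"
  shows "mat_bracket X Y \<in> lower_central n L (Suc i)"
proof -
  let ?S = "{mat_bracket X Y |X Y. X \<in> L \<and> Y \<in> lower_central n L i}"
  have "?S \<subseteq> carrier_mat n n"
    using assms(1) lower_central_subspace[OF assms(1), of i]
    by (auto simp: lie_subalgebra_iff mat_subspace_def intro!: mat_bracket_carrier)
  from mat_span_superset[OF this] show ?thesis using assms by auto
qed

text \<open>A derivation of \<open>L\<close> preserves each term of the series: by the Jacobi
  identity it does so on the brackets that span the term.\<close>

lemma lower_central_bracket_closed:
  fixes Z :: "'a::field mat"
  assumes L: "lie_subalgebra n L" and Z: "Z \<in> carrier_mat n n"
    and closed: "\<And>X. X \<in> L \<Longrightarrow> mat_bracket Z X \<in> L"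
  shows "X \<in> lower_central n L i \<Longrightarrow> mat_bracket Z X \<in> lower_central n L i"
proof (induction i arbitrary: X)
  case 0
  then show ?case using closed by simp
next
  case (Suc i)
  let ?S = "{mat_bracket X Y |X Y. X \<in> L \<and> Y \<in> lower_central n L i}"
  let ?T = "{X \<in> carrier_mat n n. mat_bracket Z X \<in> lower_central n L (Suc i)}"
  note D = mat_subspace_D[OF conjunct1[OF lower_central_subspace[OF L, of "Suc i"]]]
  have Lc: "L \<subseteq> carrier_mat n n" using L by (auto simp: lie_subalgebra_iff mat_subspace_def)
  have lc: "lower_central n L i \<subseteq> carrier_mat n n"
    using lower_central_subspace[OF L, of i] by (auto simp: mat_subspace_def)
  have "mat_subspace n ?T"
    unfolding mat_subspace_def
    using Z by (auto simp: mat_bracket_zero_right mat_bracket_add[of _ n] mat_bracket_smult[of _ n]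
        simp del: lower_central.simps intro: D(2-4))
  moreover have "?S \<subseteq> ?T"
  proof
    fix W assume "W \<in> ?S"
    then obtain X Y where XY: "X \<in> L" "Y \<in> lower_central n L i" and W: "W = mat_bracket X Y" by auto
    then have c: "X \<in> carrier_mat n n" "Y \<in> carrier_mat n n" using Lc lc by auto
    have "mat_bracket (mat_bracket Z X) Y \<in> lower_central n L (Suc i)"
      "mat_bracket X (mat_bracket Z Y) \<in> lower_central n L (Suc i)"
      using XY closed Suc.IH by (auto intro!: mat_bracket_in_lower_central[OF L] simp del: lower_central.simps)
    then have "mat_bracket Z W \<in> lower_central n L (Suc i)"
      unfolding W mat_bracket_jacobi[OF c Z] by (rule D(3))
    then show "W \<in> ?T" using c W by (simp del: lower_central.simps)
  qed
  ultimately have "mat_span n ?S \<subseteq> ?T" by (rule mat_span_least[rotated])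
  then show ?case using Suc.prems by auto
qed

lemma lower_central_zero_mono:
  assumes L: "lie_subalgebra n L" and "lower_central n L i = {0\<^sub>m n n}" "i \<le> j"
  shows "lower_central n L j = {0\<^sub>m n n}"
  using assms(3)
proof (induction j rule: dec_induct)
  case (step j)
  have "{mat_bracket X Y |X Y. X \<in> L \<and> Y \<in> lower_central n L j} \<subseteq> {0\<^sub>m n n}"
    using step L by (auto simp: mat_bracket_zero_right lie_subalgebra_iff mat_subspace_def)
  moreover have "mat_subspace n {0\<^sub>m n n :: 'a mat}" by (simp add: mat_subspace_def)
  ultimately have "lower_central n L (Suc j) \<subseteq> {0\<^sub>m n n}" by (simp add: mat_span_least)
  moreover have "0\<^sub>m n n \<in> lower_central n L (Suc j)"
    using lower_central_subspace[OF L, of "Suc j"] by (simp add: mat_subspace_def del: lower_central.simps)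
  ultimately show ?case by blast
qed (use assms in simp)

text \<open>The series stays zero once it vanishes, so a nonzero term at \<open>m\<close> takes care
  of all smaller indices.\<close>

lemma has_nilpotency_degreeI:
  assumes "lie_subalgebra n L" "lower_central n L (Suc m) = {0\<^sub>m n n}" "lower_central n L m \<noteq> {0\<^sub>m n n}"
  shows "has_nilpotency_degree n L (Suc m)"
  unfolding has_nilpotency_degree_def
  using assms lower_central_zero_mono[OF assms(1), of _ m]
  by (auto simp del: lower_central.simps simp: less_Suc_eq_le)

section \<open>Rank bounds from few entries\<close>

lemma (in vec_space) rank_ge_1:
  assumes A: "A \<in> carrier_mat n nc" and "i < n" "j < nc" "A $$ (i, j) \<noteq> 0"
  shows "rank A \<ge> 1"
proof -
  have "lin_indpt {col A j}"
  proof (rule finite_lin_indpt2)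
    show "{col A j} \<subseteq> carrier_vec n" using A by auto
    fix a :: "'a vec \<Rightarrow> 'a"
    assume "lincomb a {col A j} = 0\<^sub>v n"
    then have "lincomb a {col A j} $ i = 0" using assms by simp
    then have "a (col A j) * A $$ (i, j) = 0"
      using assms by (subst (asm) lincomb_index) auto
    then show "\<forall>v\<in>{col A j}. a v = 0" using assms by simp
  qed simp
  then have "card {col A j} \<le> rank A"
    using A assms(3) by (intro rank_ge_card_indpt) (auto simp: cols_def)
  then show ?thesis by simp
qed

text \<open>The 2 by 2 submatrix in rows \<open>i\<close>, \<open>i'\<close> and columns
  \<open>j\<close>, \<open>j'\<close> is diagonal and invertible, so these two columns are
  independent.\<close>

lemma (in vec_space) rank_ge_2:
  assumes A: "A \<in> carrier_mat n nc" and "i < n" "i' < n" "j < nc" "j' < nc"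
    "A $$ (i, j) \<noteq> 0" "A $$ (i', j') \<noteq> 0" "A $$ (i, j') = 0" "A $$ (i', j) = 0"
  shows "rank A \<ge> 2"
proof -
  have ne: "col A j \<noteq> col A j'"
  proof
    assume "col A j = col A j'"
    then have "col A j $ i = col A j' $ i" by simp
    then show False using assms by simp
  qed
  have "lin_indpt {col A j, col A j'}"
  proof (rule finite_lin_indpt2)
    show "{col A j, col A j'} \<subseteq> carrier_vec n" using A by auto
    fix a :: "'a vec \<Rightarrow> 'a"
    assume *: "lincomb a {col A j, col A j'} = 0\<^sub>v n"
    then have "lincomb a {col A j, col A j'} $ i = 0" using assms by simp
    then have "a (col A j) * A $$ (i, j) = 0"
      using assms ne by (subst (asm) lincomb_index) auto
    moreover have "lincomb a {col A j, col A j'} $ i' = 0" using assms * by simp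
    then have "a (col A j') * A $$ (i', j') = 0"
      using assms ne by (subst (asm) lincomb_index) auto
    ultimately show "\<forall>v\<in>{col A j, col A j'}. a v = 0" using assms by simp
  qed simp
  then have "card {col A j, col A j'} \<le> rank A"
    using A assms(4,5) by (intro rank_ge_card_indpt) (auto simp: cols_def)
  then show ?thesis using ne by simp
qed

lemma (in vec_space) rank_le_1_single_entry:
  assumes "A \<in> carrier_mat n nc" "\<And>r c. r < n \<Longrightarrow> c < nc \<Longrightarrow> (r, c) \<noteq> (i, j) \<Longrightarrow> A $$ (r, c) = 0"
  shows "rank A \<le> 1"
  by (rule rank_le_1_product_entries[of _ nc "\<lambda>r. if r = i then A $$ (i, j) else 0" "\<lambda>c. of_bool (c = j)"])
    (use assms in auto)

text \<open>Splitting off the entry at \<open>(i, j)\<close> writes the matrix as a sum of two with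
  at most one nonzero entry each, and rank is subadditive.\<close>

lemma (in vec_space) rank_le_2_two_entries:
  assumes A: "A \<in> carrier_mat n nc"
    and z: "\<And>r c. r < n \<Longrightarrow> c < nc \<Longrightarrow> (r, c) \<noteq> (i, j) \<Longrightarrow> (r, c) \<noteq> (i', j') \<Longrightarrow> A $$ (r, c) = 0"
  shows "rank A \<le> 2"
proof -
  define B where "B = mat n nc (\<lambda>(r, c). if (r, c) = (i, j) then A $$ (r, c) else 0)"
  have B: "B \<in> carrier_mat n nc" by (simp add: B_def)
  have "B + (A - B) = A" using A B by (intro eq_matI) auto
  then have "rank (B + (A - B)) = rank A" by simp
  moreover have "rank B \<le> 1"
    by (rule rank_le_1_single_entry[of _ nc i j]) (auto simp: B_def)
  moreover have "rank (A - B) \<le> 1"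
    by (rule rank_le_1_single_entry[of _ nc i' j']) (use A z in \<open>auto simp: B_def\<close>)
  moreover have "rank (B + (A - B)) \<le> rank B + rank (A - B)"
    using A B by (intro rank_subadditive) auto
  ultimately show ?thesis by linarith
qed

section \<open>Lie polynomials of the two superdiagonal matrices\<close>

lemma letter_mat_carrier [simp]: "letter_mat w z \<in> carrier_mat (Suc (length w)) (Suc (length w))"
  by (simp add: letter_mat_def)

text \<open>The value at \<open>(D, E)\<close> of the right-normed bracket of the letters
  \<open>xs\<close>; the empty bracket is 0, as for \<open>lie_coeff\<close>.\<close>

fun lie_mat :: "bool list \<Rightarrow> bool list \<Rightarrow> 'a::field mat" where
  "lie_mat w [] = 0\<^sub>m (Suc (length w)) (Suc (length w))"
| "lie_mat w [x] = letter_mat w x"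
| "lie_mat w (x # y # zs) = mat_bracket (letter_mat w x) (lie_mat w (y # zs))"

lemma lie_mat_Cons: "xs \<noteq> [] \<Longrightarrow> lie_mat w (x # xs) = mat_bracket (letter_mat w x) (lie_mat w xs)"
  by (cases xs) auto

lemma lie_mat_carrier [simp]: "lie_mat w xs \<in> carrier_mat (Suc (length w)) (Suc (length w))"
  by (induction w xs rule: lie_mat.induct) (auto intro!: mat_bracket_carrier simp del: carrier_mat_triv)

text \<open>The letters met along the superdiagonal on the way from index \<open>r\<close> to index
  \<open>c\<close>.\<close>

definition window :: "'a list \<Rightarrow> nat \<Rightarrow> nat \<Rightarrow> 'a list" where
  "window w r c = take (c - r) (drop r w)"

lemma window_props:
  assumes "r < c" "c \<le> length w"
  shows "window w r c \<noteq> []" "hd (window w r c) = w ! r" "last (window w r c) = w ! (c - 1)"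
    "tl (window w r c) = window w (Suc r) c" "butlast (window w r c) = window w r (c - 1)"
proof -
  show "window w r c \<noteq> []" using assms by (simp add: window_def)
  then show "hd (window w r c) = w ! r" "last (window w r c) = w ! (c - 1)"
    using assms by (simp_all add: window_def hd_conv_nth last_conv_nth)
  show "tl (window w r c) = window w (Suc r) c"
    using assms by (simp add: window_def tl_take tl_drop drop_Suc)
  show "butlast (window w r c) = window w r (c - 1)"
    using assms by (simp add: window_def butlast_take diff_commute)
qed

lemma letter_mat_mult_left:
  assumes "r < Suc (length w)" "c < Suc (length w)"
  shows "(\<Sum>l<Suc (length w). letter_mat w x $$ (r, l) * M $$ (l, c)) =
    (if Suc r < Suc (length w) \<and> w ! r = x then M $$ (Suc r, c) else 0)"
proof -
  have "(\<Sum>l<Suc (length w). letter_mat w x $$ (r, l) * M $$ (l, c)) =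
      (\<Sum>l<Suc (length w). if l = Suc r then of_bool (w ! r = x) * M $$ (Suc r, c) else 0)"
    using assms by (intro sum.cong) (auto simp: letter_mat_def)
  also have "\<dots> = (if Suc r < Suc (length w) \<and> w ! r = x then M $$ (Suc r, c) else 0)"
    by (subst sum.delta) auto
  finally show ?thesis .
qed

lemma letter_mat_mult_right:
  assumes "r < Suc (length w)" "c < Suc (length w)"
  shows "(\<Sum>l<Suc (length w). M $$ (r, l) * letter_mat w x $$ (l, c)) =
    (if 0 < c \<and> w ! (c - 1) = x then M $$ (r, c - 1) else 0)"
proof (cases c)
  case 0
  then show ?thesis using assms by (intro trans[OF sum.neutral]) (auto simp: letter_mat_def)
next
  case (Suc c')
  have "(\<Sum>l<Suc (length w). M $$ (r, l) * letter_mat w x $$ (l, c)) =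
      (\<Sum>l<Suc (length w). if l = c' then of_bool (w ! c' = x) * M $$ (r, c') else 0)"
    using assms Suc by (intro sum.cong) (auto simp: letter_mat_def)
  also have "\<dots> = (if 0 < c \<and> w ! (c - 1) = x then M $$ (r, c - 1) else 0)"
    using Suc assms by (subst sum.delta) auto
  finally show ?thesis .
qed

text \<open>A product of letter matrices has a nonzero entry at \<open>(r, c)\<close> only if it
  spells the factor of \<open>w\<close> from \<open>r\<close> to \<open>c\<close>. Multiplying by a
  letter from the left or the right removes the first or the last letter of this factor, which is
  the recursion of \<open>ad_coeff\<close>.\<close>

lemma lie_mat_index:
  assumes "r < Suc (length w)" "c < Suc (length w)"
  shows "(lie_mat w xs :: 'a::field mat) $$ (r, c) =
    (if r \<le> c then of_int (lie_coeff xs (window w r c)) else 0)"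
  using assms
proof (induction xs arbitrary: r c)
  case (Cons x xs)
  show ?case
  proof (cases "xs = []")
    case True
    have "window w r c = [x] \<longleftrightarrow> c = Suc r \<and> w ! r = x" if "r \<le> c"
    proof (cases "c = Suc r")
      case True
      then have "length (window w r c) = 1" "hd (window w r c) = w ! r"
        using Cons.prems window_props(2)[of r c w] by (auto simp: window_def)
      then show ?thesis using True by (cases "window w r c") auto
    next
      case False
      have "length (window w r c) = c - r" using Cons.prems by (simp add: window_def)
      then show ?thesis using False that by (cases "window w r c") auto
    qed
    then show ?thesis using True Cons.prems by (auto simp: letter_mat_def)
  next
    case False
    let ?M = "lie_mat w xs :: 'a mat"
    have eq: "(lie_mat w (x # xs) :: 'a mat) $$ (r, c) =
        (if Suc r < Suc (length w) \<and> w ! r = x then ?M $$ (Suc r, c) else 0) -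
        (if 0 < c \<and> w ! (c - 1) = x then ?M $$ (r, c - 1) else 0)"
      unfolding lie_mat_Cons[OF False]
      by (subst mat_bracket_index[OF letter_mat_carrier lie_mat_carrier Cons.prems])
        (simp only: letter_mat_mult_left[OF Cons.prems] letter_mat_mult_right[OF Cons.prems])
    consider "r < c" | "r = c" | "c < r" by linarith
    then show ?thesis
    proof cases
      case 1
      then have "c \<le> length w" using Cons.prems by simp
      note wp = window_props[OF 1 this]
      have "?M $$ (Suc r, c) = of_int (lie_coeff xs (window w (Suc r) c))"
        "?M $$ (r, c - 1) = of_int (lie_coeff xs (window w r (c - 1)))"
        using Cons.IH[of "Suc r" c] Cons.IH[of r "c - 1"] Cons.prems 1 by auto
      then show ?thesis
        using 1 Cons.prems wp by (simp add: eq lie_coeff_Cons[OF False] ad_coeff_def)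
    next
      case 2
      have "?M $$ (Suc r, c) = 0" if "Suc r < Suc (length w)"
        using Cons.IH[of "Suc r" c] Cons.prems 2 that by auto
      moreover have "?M $$ (r, c - 1) = 0" if "0 < c"
        using Cons.IH[of r "c - 1"] Cons.prems 2 that by auto
      ultimately show ?thesis unfolding eq using 2 by (cases "c = 0") (auto simp: lie_coeff_Cons[OF False] ad_coeff_def window_def)
    next
      case 3
      have "?M $$ (Suc r, c) = 0" if "Suc r < Suc (length w)"
        using Cons.IH[of "Suc r" c] Cons.prems 3 that by auto
      moreover have "?M $$ (r, c - 1) = 0" if "0 < c"
        using Cons.IH[of r "c - 1"] Cons.prems 3 that by auto
      ultimately show ?thesis unfolding eq using 3 by (cases "c = 0") auto
    qed
  qed
qed simp

text \<open>Homogeneity in matrix form: a bracket of \<open>m\<close> letters is supported on the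
  \<open>m\<close>-th superdiagonal.\<close>

lemma lie_mat_index_length:
  assumes "r < Suc (length w)" "c < Suc (length w)" "(lie_mat w xs :: 'a::field mat) $$ (r, c) \<noteq> 0"
  shows "c = r + length xs"
proof -
  have "r \<le> c" "lie_coeff xs (window w r c) \<noteq> 0"
    using assms lie_mat_index[OF assms(1,2), of xs, where 'a='a] by (auto split: if_splits)
  moreover have "length (window w r c) = c - r" using assms by (simp add: window_def)
  ultimately show ?thesis using lie_coeff_length[of xs "window w r c"] by simp
qed

section \<open>The two Lie algebras attached to a word\<close>

definition word_n_alg :: "bool list \<Rightarrow> 'a::field mat set" where
  "word_n_alg w = lie_generated (Suc (length w))
    {((mat_bracket (letter_mat w False)) ^^ l) (letter_mat w True) | l. True}"

definition word_h_alg :: "bool list \<Rightarrow> 'a::field mat set" where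
  "word_h_alg w = lie_generated (Suc (length w)) {letter_mat w False, letter_mat w True}"

lemma ad_power_carrier:
  "((mat_bracket (letter_mat w False)) ^^ l) (letter_mat w True) \<in> carrier_mat (Suc (length w)) (Suc (length w))"
  by (induction l) (auto intro!: mat_bracket_carrier simp del: carrier_mat_triv)

lemma word_n_alg_subalgebra: "lie_subalgebra (Suc (length w)) (word_n_alg w)"
  unfolding word_n_alg_def using ad_power_carrier by (intro lie_generated_subalgebra) blast

lemma word_h_alg_subalgebra: "lie_subalgebra (Suc (length w)) (word_h_alg w)"
  unfolding word_h_alg_def by (intro lie_generated_subalgebra) auto

lemma letter_mat_in_word_h_alg: "letter_mat w z \<in> word_h_alg w"
  unfolding word_h_alg_def by (rule subsetD[OF lie_generated_superset]) (cases z; simp)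

lemma E_in_word_n_alg: "letter_mat w True \<in> word_n_alg w"
  unfolding word_n_alg_def
  by (rule subsetD[OF lie_generated_superset]) (auto intro!: exI[of _ 0])

lemma word_n_alg_ad_D:
  assumes "X \<in> word_n_alg w"
  shows "mat_bracket (letter_mat w False) X \<in> word_n_alg w"
  using assms unfolding word_n_alg_def
proof (rule lie_generated_bracket_closed[rotated 3])
  let ?S = "{((mat_bracket (letter_mat w False)) ^^ l) (letter_mat w True) | l. True}"
  show "?S \<subseteq> carrier_mat (Suc (length w)) (Suc (length w))" using ad_power_carrier by blast
  fix X assume "X \<in> ?S"
  then obtain l where "X = ((mat_bracket (letter_mat w False)) ^^ l) (letter_mat w True)" by blast
  then have "mat_bracket (letter_mat w False) X = ((mat_bracket (letter_mat w False)) ^^ (Suc l)) (letter_mat w True)"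
    by simp
  then have "mat_bracket (letter_mat w False) X \<in> ?S" by blast
  then show "mat_bracket (letter_mat w False) X \<in> lie_generated (Suc (length w)) ?S"
    by (rule subsetD[OF lie_generated_superset])
qed simp

lemma word_n_alg_subset_h_alg: "(word_n_alg w :: 'a::field mat set) \<subseteq> word_h_alg w"
  unfolding word_n_alg_def
proof (rule lie_generated_least[OF _ word_h_alg_subalgebra])
  have "((mat_bracket (letter_mat w False)) ^^ l) (letter_mat w True :: 'a mat) \<in> word_h_alg w" for l
  proof (induction l)
    case (Suc l)
    then show ?case
      using word_h_alg_subalgebra[of w, where 'a='a] letter_mat_in_word_h_alg[of w False, where 'a='a] by (simp add: lie_subalgebra_iff)
  qed (simp add: letter_mat_in_word_h_alg)
  then show "{((mat_bracket (letter_mat w False)) ^^ l) (letter_mat w True :: 'a mat) | l. True} \<subseteq> word_h_alg w"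
    by blast
qed

lemma lie_mat_in_word_h_alg: "(lie_mat w xs :: 'a::field mat) \<in> word_h_alg w"
  using word_h_alg_subalgebra[of w, where 'a='a]
  by (induction w xs rule: lie_mat.induct)
    (auto simp: letter_mat_in_word_h_alg lie_subalgebra_iff mat_subspace_def)

lemma lie_mat_only_D:
  "True \<notin> set xs \<Longrightarrow> length xs \<ge> 2 \<Longrightarrow> lie_mat w xs = 0\<^sub>m (Suc (length w)) (Suc (length w))"
proof (induction w xs rule: lie_mat.induct)
  case (3 w x y zs)
  then show ?case
  proof (cases "zs = []")
    case True
    then show ?thesis using 3 by (simp add: mat_bracket_self[OF letter_mat_carrier])
  next
    case False
    then show ?thesis using 3 by (cases zs) (auto simp: mat_bracket_zero_right[OF letter_mat_carrier])
  qed
qed auto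

text \<open>Bracketing with \<open>D\<close> preserves each term of the series, and bracketing with
  \<open>E\<close> leads to the next one. The innermost \<open>E\<close> only brings the element
  into the algebra, hence the \<open>- 1\<close>.\<close>

lemma lie_mat_in_lower_central:
  "count_list xs True \<ge> 1 \<Longrightarrow>
    (lie_mat w xs :: 'a::field mat) \<in> lower_central (Suc (length w)) (word_n_alg w) (count_list xs True - 1)"
proof (induction xs)
  case (Cons x xs)
  let ?n = "Suc (length w)" and ?L = "word_n_alg w :: 'a mat set"
  note L = word_n_alg_subalgebra[of w, where 'a='a]
  show ?case
  proof (cases "xs = []")
    case True
    then show ?thesis using Cons.prems E_in_word_n_alg by (cases x) auto
  next
    case ne: False
    show ?thesis
    proof (cases x)
      case False
      then have "lie_mat w xs \<in> lower_central ?n ?L (count_list xs True - 1)" using Cons by simp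
      from lower_central_bracket_closed[OF L letter_mat_carrier word_n_alg_ad_D this]
      show ?thesis using False ne by (simp add: lie_mat_Cons)
    next
      case True
      show ?thesis
      proof (cases "count_list xs True \<ge> 1")
        case ge: True
        then have "lie_mat w xs \<in> lower_central ?n ?L (count_list xs True - 1)" using Cons by simp
        from mat_bracket_in_lower_central[OF L E_in_word_n_alg this]
        show ?thesis using True ne ge by (simp add: lie_mat_Cons del: lower_central.simps)
      next
        \<comment> \<open>The tail has no letter \<open>E\<close>, so it is 0 or \<open>D\<close>
          and the induction hypothesis does not reach it. In the second case
          \<open>[E, D] = - [D, E]\<close> lies in the algebra.\<close>
        case False
        then have c0: "count_list xs True = 0" by simp
        then have noT: "True \<notin> set xs" by (simp add: count_list_0_iff)
        have "mat_bracket (letter_mat w True) (lie_mat w xs) \<in> ?L"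
        proof (cases "length xs \<ge> 2")
          case True
          then show ?thesis
            using L
            by (simp add: lie_mat_only_D[OF noT] mat_bracket_zero_right[OF letter_mat_carrier]
                lie_subalgebra_iff mat_subspace_def)
        next
          case False
          with ne noT have "xs = [False]" by (cases xs; cases "tl xs") auto
          moreover have "mat_bracket (letter_mat w True) (letter_mat w False) =
              (-1) \<cdot>\<^sub>m mat_bracket (letter_mat w False) (letter_mat w True :: 'a mat)"
            by (rule mat_bracket_swap[OF letter_mat_carrier letter_mat_carrier])
          moreover have "(-1) \<cdot>\<^sub>m mat_bracket (letter_mat w False) (letter_mat w True :: 'a mat) \<in> ?L"
            using L word_n_alg_ad_D[OF E_in_word_n_alg[of w, where 'a='a]] by (simp add: lie_subalgebra_iff mat_subspace_def)
          ultimately show ?thesis by simp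
        qed
        then show ?thesis using True c0 ne by (simp add: lie_mat_Cons)
      qed
    qed
  qed
qed simp

text \<open>The number of letters \<open>E\<close> in \<open>take r w\<close> is the number, from 0,
  of the block containing index \<open>r\<close>. So nonzero entries have to lie at least
  \<open>m\<close> blocks to the right of the diagonal blocks, and these degrees add under
  products.\<close>

definition E_filtration :: "bool list \<Rightarrow> nat \<Rightarrow> 'a::field mat set" where
  "E_filtration w m = {X \<in> carrier_mat (Suc (length w)) (Suc (length w)).
    \<forall>r < Suc (length w). \<forall>c < Suc (length w). X $$ (r, c) \<noteq> 0 \<longrightarrow>
      count_list (take r w) True + m \<le> count_list (take c w) True}"

lemma E_filtration_D:
  "X \<in> E_filtration w m \<Longrightarrow> r < Suc (length w) \<Longrightarrow> c < Suc (length w) \<Longrightarrow> X $$ (r, c) \<noteq> 0 \<Longrightarrow>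
    count_list (take r w) True + m \<le> count_list (take c w) True"
  by (auto simp: E_filtration_def)

lemma E_filtration_subspace: "mat_subspace (Suc (length w)) (E_filtration w m)"
  unfolding mat_subspace_def
proof (intro conjI ballI allI)
  fix X Y :: "'a mat" assume XY: "X \<in> E_filtration w m" "Y \<in> E_filtration w m"
  show "X + Y \<in> E_filtration w m"
    unfolding E_filtration_def
  proof (intro CollectI conjI allI impI)
    fix r c assume rc: "r < Suc (length w)" "c < Suc (length w)" "(X + Y) $$ (r, c) \<noteq> 0"
    then have "X $$ (r, c) \<noteq> 0 \<or> Y $$ (r, c) \<noteq> 0" using XY by (auto simp: E_filtration_def)
    then show "count_list (take r w) True + m \<le> count_list (take c w) True"
      using XY rc E_filtration_D by blast
  qed (use XY in \<open>auto simp: E_filtration_def\<close>)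
qed (auto simp: E_filtration_def)

lemma E_filtration_bracket:
  fixes X Y :: "'a::field mat"
  assumes "X \<in> E_filtration w a" "Y \<in> E_filtration w b"
  shows "mat_bracket X Y \<in> E_filtration w (a + b)"
proof -
  let ?n = "Suc (length w)"
  have c: "X \<in> carrier_mat ?n ?n" "Y \<in> carrier_mat ?n ?n" using assms by (auto simp: E_filtration_def)
  show ?thesis
    unfolding E_filtration_def
  proof (intro CollectI conjI allI impI)
    show "mat_bracket X Y \<in> carrier_mat ?n ?n" using c by (rule mat_bracket_carrier)
    fix r s assume rs: "r < ?n" "s < ?n" and "mat_bracket X Y $$ (r, s) \<noteq> 0"
    then have "(\<Sum>l<?n. X $$ (r, l) * Y $$ (l, s)) \<noteq> 0 \<or> (\<Sum>l<?n. Y $$ (r, l) * X $$ (l, s)) \<noteq> 0"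
      using mat_bracket_index[OF c rs] by (metis diff_self)
    then show "count_list (take r w) True + (a + b) \<le> count_list (take s w) True"
    proof
      assume "(\<Sum>l<?n. X $$ (r, l) * Y $$ (l, s)) \<noteq> 0"
      then obtain l where "l < ?n" "X $$ (r, l) * Y $$ (l, s) \<noteq> 0"
        by (meson lessThan_iff sum.not_neutral_contains_not_neutral)
      then show ?thesis
        using E_filtration_D[OF assms(1) rs(1), of l] E_filtration_D[OF assms(2) _ rs(2), of l] by simp
    next
      assume "(\<Sum>l<?n. Y $$ (r, l) * X $$ (l, s)) \<noteq> 0"
      then obtain l where "l < ?n" "Y $$ (r, l) * X $$ (l, s) \<noteq> 0"
        by (meson lessThan_iff sum.not_neutral_contains_not_neutral)
      then show ?thesis
        using E_filtration_D[OF assms(2) rs(1), of l] E_filtration_D[OF assms(1) _ rs(2), of l] by simp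
    qed
  qed
qed

lemma E_filtration_mono: "a \<le> b \<Longrightarrow> E_filtration w b \<subseteq> E_filtration w a"
  by (fastforce simp: E_filtration_def)

lemma letter_mat_in_E_filtration: "letter_mat w z \<in> E_filtration w (of_bool z)"
  by (auto simp: E_filtration_def letter_mat_def take_Suc_conv_app_nth)

lemma word_n_alg_E_filtration: "(word_n_alg w :: 'a::field mat set) \<subseteq> E_filtration w 1"
  unfolding word_n_alg_def
proof (rule lie_generated_least)
  have "((mat_bracket (letter_mat w False)) ^^ l) (letter_mat w True :: 'a mat) \<in> E_filtration w 1" for l
  proof (induction l)
    case 0
    show ?case using letter_mat_in_E_filtration[of w True] by simp
  next
    case (Suc l)
    then show ?case
      using E_filtration_bracket[OF letter_mat_in_E_filtration[of w False] Suc] by simp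
  qed
  then show "{((mat_bracket (letter_mat w False)) ^^ l) (letter_mat w True :: 'a mat) | l. True} \<subseteq> E_filtration w 1"
    by blast
  have "mat_bracket X Y \<in> E_filtration w 1" if "X \<in> E_filtration w 1" "Y \<in> E_filtration w 1" for X Y :: "'a mat"
    using E_filtration_bracket[OF that] by (rule rev_subsetD) (rule E_filtration_mono, simp)
  then show "lie_subalgebra (Suc (length w)) (E_filtration w 1 :: 'a mat set)"
    unfolding lie_subalgebra_iff using E_filtration_subspace by blast
qed

lemma lower_central_E_filtration:
  "lower_central (Suc (length w)) (word_n_alg w :: 'a::field mat set) i \<subseteq> E_filtration w (Suc i)"
proof (induction i)
  case 0
  then show ?case using word_n_alg_E_filtration by simp
next
  case (Suc i)
  have "mat_bracket X Y \<in> E_filtration w (Suc (Suc i))"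
    if "X \<in> word_n_alg w" "Y \<in> lower_central (Suc (length w)) (word_n_alg w) i" for X Y :: "'a mat"
  proof -
    have "X \<in> E_filtration w 1" "Y \<in> E_filtration w (Suc i)"
      using that word_n_alg_E_filtration Suc by auto
    from E_filtration_bracket[OF this] show ?thesis by simp
  qed
  then have "{mat_bracket X Y |X Y. X \<in> (word_n_alg w :: 'a mat set) \<and>
      Y \<in> lower_central (Suc (length w)) (word_n_alg w) i} \<subseteq> E_filtration w (Suc (Suc i))"
    by blast
  then show ?case using mat_span_least[OF _ E_filtration_subspace] by simp
qed

lemma subspace_zero_iff:
  assumes "mat_subspace n L"
  shows "L = {0\<^sub>m n n} \<longleftrightarrow> (\<forall>X\<in>L. \<forall>r<n. \<forall>c<n. X $$ (r, c) = 0)"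
proof
  assume "\<forall>X\<in>L. \<forall>r<n. \<forall>c<n. X $$ (r, c) = 0"
  then have "X = 0\<^sub>m n n" if "X \<in> L" for X
    using that mat_subspace_D(1)[OF assms] by (intro eq_matI) auto
  then show "L = {0\<^sub>m n n}" using mat_subspace_D(2)[OF assms] by blast
qed simp

lemma count_list_take_le: "count_list (take r w) x \<le> count_list w x"
  by (metis append_take_drop_id count_list_append le_add1)

text \<open>A nonzero entry in term \<open>i\<close> would have to pass \<open>Suc i\<close> letters
  \<open>E\<close>, more than \<open>w\<close> contains.\<close>

lemma lower_central_top_zero:
  assumes "count_list w True \<le> i"
  shows "lower_central (Suc (length w)) (word_n_alg w :: 'a::field mat set) i = {0\<^sub>m (Suc (length w)) (Suc (length w))}"
proof (subst subspace_zero_iff)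
  show "mat_subspace (Suc (length w)) (lower_central (Suc (length w)) (word_n_alg w :: 'a mat set) i)"
    using lower_central_subspace[OF word_n_alg_subalgebra] by blast
  have "count_list (take c w) True < count_list (take r w) True + Suc i" for r c
    using count_list_take_le[of c w True] assms by linarith
  then show "\<forall>X\<in>lower_central (Suc (length w)) (word_n_alg w :: 'a mat set) i.
      \<forall>r<Suc (length w). \<forall>c<Suc (length w). X $$ (r, c) = 0"
    using lower_central_E_filtration[of w i] E_filtration_D[of _ w "Suc i"] by (metis not_le subsetD)
qed

text \<open>The matrices that are skew-adjoint for the form pairing \<open>e_r\<close> with
  \<open>e_(n-1-r)\<close> to the value \<open>(-1)^r\<close>. This form is symmetric for odd
  \<open>n\<close> and alternating for even \<open>n\<close>.\<close>

definition antitranspose_skew :: "nat \<Rightarrow> 'a::field mat set" where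
  "antitranspose_skew n = {X \<in> carrier_mat n n. \<forall>r<n. \<forall>c<n.
    X $$ (n - 1 - c, n - 1 - r) = (-1) ^ (r + c + 1) * X $$ (r, c)}"

lemma antitranspose_skew_D:
  "X \<in> antitranspose_skew n \<Longrightarrow> r < n \<Longrightarrow> c < n \<Longrightarrow>
    X $$ (n - 1 - c, n - 1 - r) = (-1) ^ (r + c + 1) * X $$ (r, c)"
  by (simp add: antitranspose_skew_def)

text \<open>Taking adjoints reverses products. With the summation index reflected, the symmetry
  applies to both factors, and the contributions of \<open>l\<close> to the sign cancel.\<close>

lemma antitranspose_skew_mult:
  fixes X Y :: "'a::field mat"
  assumes "X \<in> antitranspose_skew n" "Y \<in> antitranspose_skew n" "r < n" "c < n"
  shows "(\<Sum>l<n. X $$ (n - 1 - c, l) * Y $$ (l, n - 1 - r)) = (-1) ^ (r + c) * (\<Sum>l<n. Y $$ (r, l) * X $$ (l, c))"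
proof -
  have "(\<Sum>l<n. X $$ (n - 1 - c, l) * Y $$ (l, n - 1 - r)) =
      (\<Sum>l<n. X $$ (n - 1 - c, n - 1 - l) * Y $$ (n - 1 - l, n - 1 - r))"
    by (rule sum.reindex_bij_witness[of _ "\<lambda>l. n - 1 - l" "\<lambda>l. n - 1 - l"]) auto
  also have "\<dots> = (\<Sum>l<n. (-1) ^ (r + c) * (Y $$ (r, l) * X $$ (l, c)))"
  proof (rule sum.cong[OF refl])
    fix l assume l: "l \<in> {..<n}"
    have "(-1) ^ (l + c + 1) * (-1) ^ (r + l + 1) = ((-1) ^ (r + c) :: 'a)"
      by (simp add: power_add algebra_simps)
    then have "((-1) ^ (l + c + 1) * X $$ (l, c)) * ((-1) ^ (r + l + 1) * Y $$ (r, l)) =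
        (-1) ^ (r + c) * (Y $$ (r, l) * X $$ (l, c))"
      by (metis (no_types, opaque_lifting) mult.assoc mult.commute mult.left_commute)
    then show "X $$ (n - 1 - c, n - 1 - l) * Y $$ (n - 1 - l, n - 1 - r) =
        (-1) ^ (r + c) * (Y $$ (r, l) * X $$ (l, c))"
      using l assms by (simp only: antitranspose_skew_D lessThan_iff)
  qed
  also have "\<dots> = (-1) ^ (r + c) * (\<Sum>l<n. Y $$ (r, l) * X $$ (l, c))"
    by (simp add: sum_distrib_left)
  finally show ?thesis .
qed

lemma antitranspose_skew_subalgebra: "lie_subalgebra n (antitranspose_skew n :: 'a::field mat set)"
  unfolding lie_subalgebra_iff mat_subspace_def
proof (intro conjI ballI allI)
  fix X Y :: "'a mat" assume XY: "X \<in> antitranspose_skew n" "Y \<in> antitranspose_skew n"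
  then have c: "X \<in> carrier_mat n n" "Y \<in> carrier_mat n n" by (auto simp: antitranspose_skew_def)
  show "X + Y \<in> antitranspose_skew n"
    using XY c by (auto simp: antitranspose_skew_def algebra_simps)
  show "mat_bracket X Y \<in> antitranspose_skew n"
    unfolding antitranspose_skew_def
  proof (intro CollectI conjI allI impI)
    show "mat_bracket X Y \<in> carrier_mat n n" using c by (rule mat_bracket_carrier)
    fix r s assume rs: "r < n" "s < n"
    then have rs': "n - 1 - s < n" "n - 1 - r < n" by auto
    show "mat_bracket X Y $$ (n - 1 - s, n - 1 - r) = (-1) ^ (r + s + 1) * mat_bracket X Y $$ (r, s)"
      unfolding mat_bracket_index[OF c rs] mat_bracket_index[OF c rs']
        antitranspose_skew_mult[OF XY rs] antitranspose_skew_mult[OF XY(2,1) rs]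
      by (simp add: algebra_simps)
  qed
next
  fix a :: 'a and X :: "'a mat" assume "X \<in> antitranspose_skew n"
  then show "a \<cdot>\<^sub>m X \<in> antitranspose_skew n" by (auto simp: antitranspose_skew_def)
qed (auto simp: antitranspose_skew_def)

text \<open>Reflection in the antidiagonal carries the entry of letter \<open>r\<close> to that of
  letter \<open>length w - Suc r\<close>, which is the same letter in a palindrome; the sign is
  \<open>+\<close> because \<open>r + Suc r + 1\<close> is even.\<close>

lemma letter_mat_antitranspose_skew:
  assumes "rev w = w"
  shows "(letter_mat w z :: 'a::field mat) \<in> antitranspose_skew (Suc (length w))"
  unfolding antitranspose_skew_def
proof (intro CollectI conjI allI impI)
  fix r c assume rc: "r < Suc (length w)" "c < Suc (length w)"
  have "w ! (length w - Suc r) = w ! r" if "r < length w"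
    using that rev_nth[of r w] assms by simp
  then show "(letter_mat w z :: 'a mat) $$ (Suc (length w) - 1 - c, Suc (length w) - 1 - r) =
      (-1) ^ (r + c + 1) * letter_mat w z $$ (r, c)"
    using rc by (cases "c = Suc r") (auto simp: letter_mat_def)
qed simp

lemma word_h_alg_antitranspose_skew:
  assumes "rev w = w"
  shows "word_h_alg w \<subseteq> antitranspose_skew (Suc (length w))"
  unfolding word_h_alg_def
  by (rule lie_generated_least[OF _ antitranspose_skew_subalgebra])
    (use letter_mat_antitranspose_skew[OF assms] in auto)

section \<open>The corner block\<close>

text \<open>Pairing \<open>i\<close> with \<open>k + 1 - i\<close> gives an even sum; only for odd
  \<open>k\<close> a middle term is left over.\<close>

lemma symmetric_sum_parity:
  fixes d :: "nat \<Rightarrow> nat"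
  assumes sym: "\<forall>i\<in>{1..k}. d i = d (k + 1 - i)"
  shows "odd (\<Sum>i\<in>{1..k}. d i) \<longleftrightarrow> odd k \<and> odd (d ((k + 1) div 2))"
proof -
  define m where "m = k div 2"
  have upper: "(\<Sum>i\<in>{k + 1 - m..k}. d i) = (\<Sum>i\<in>{1..m}. d i)"
    by (rule sum.reindex_bij_witness[of _ "\<lambda>i. k + 1 - i" "\<lambda>i. k + 1 - i"])
      (use sym in \<open>auto simp: m_def\<close>)
  show ?thesis
  proof (cases "even k")
    case True
    then have "{1..k} = {1..m} \<union> {k + 1 - m..k}" by (auto simp: m_def)
    moreover have "{1..m} \<inter> {k + 1 - m..k} = {}" using True by (auto simp: m_def elim!: evenE)
    ultimately have "(\<Sum>i\<in>{1..k}. d i) = 2 * (\<Sum>i\<in>{1..m}. d i)"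
      using upper by (simp add: sum.union_disjoint)
    then show ?thesis using True by simp
  next
    case False
    then have k: "k = 2 * m + 1" by (simp add: m_def)
    have "{1..k} = insert (m + 1) ({1..m} \<union> {k + 1 - m..k})" using k by auto
    moreover have "{1..m} \<inter> {k + 1 - m..k} = {}" "m + 1 \<notin> {1..m} \<union> {k + 1 - m..k}" using k by auto
    ultimately have "(\<Sum>i\<in>{1..k}. d i) = d (m + 1) + 2 * (\<Sum>i\<in>{1..m}. d i)"
      using upper by (simp add: sum.union_disjoint)
    moreover have "(k + 1) div 2 = m + 1" using k by simp
    ultimately show ?thesis using False by simp
  qed
qed

lemma block_word_palindrome_iff:
  assumes "k \<ge> 1" "\<forall>i\<in>{1..k}. d i > 0"
  shows "rev (block_word k d) = block_word k d \<longleftrightarrow> (\<forall>i\<in>{1..k}. d i = d (k + 1 - i))"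
proof -
  let ?ds = "map d [1..<k + 1]"
  have len: "length ?ds = k" by simp
  have nth: "?ds ! j = d (Suc j)" if "j < k" for j using that by (simp del: upt_Suc)
  have "rev (block_word k d) = block_word k d \<longleftrightarrow> rev ?ds = ?ds"
    unfolding block_word_def rev_comp_word
    using comp_word_inj[of "rev ?ds" ?ds] assms by (auto simp del: upt_Suc)
  also have "\<dots> \<longleftrightarrow> (\<forall>j<k. ?ds ! (k - Suc j) = ?ds ! j)"
    using len by (simp add: list_eq_iff_nth_eq rev_nth del: upt_Suc)
  also have "\<dots> \<longleftrightarrow> (\<forall>j<k. d (k - j) = d (Suc j))"
    using nth by (simp add: Suc_diff_Suc del: upt_Suc)
  also have "\<dots> \<longleftrightarrow> (\<forall>i\<in>{1..k}. d i = d (k + 1 - i))"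
  proof
    assume *: "\<forall>j<k. d (k - j) = d (Suc j)"
    show "\<forall>i\<in>{1..k}. d i = d (k + 1 - i)"
    proof
      fix i assume "i \<in> {1..k}"
      then show "d i = d (k + 1 - i)" using *[rule_format, of "i - 1"] by auto
    qed
  next
    assume *: "\<forall>i\<in>{1..k}. d i = d (k + 1 - i)"
    show "\<forall>j<k. d (k - j) = d (Suc j)"
    proof (intro allI impI)
      fix j assume "j < k"
      then show "d (k - j) = d (Suc j)" using *[rule_format, of "Suc j"] by simp
    qed
  qed
  finally show ?thesis .
qed

text \<open>The word has \<open>total_size k d - 1\<close> letters, so its length is even when the
  total size is odd, which for symmetric \<open>d\<close> is decided by the middle term.\<close>

lemma even_palindrome_iff_odd_symmetric:
  assumes "k \<ge> 1" "\<forall>i\<in>{1..k}. d i > 0"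
  shows "even (length (block_word k d)) \<and> rev (block_word k d) = block_word k d \<longleftrightarrow> odd_symmetric k d"
proof -
  have "even (length (block_word k d)) \<longleftrightarrow> odd (total_size k d)"
    unfolding length_block_word[OF assms, symmetric] by simp
  then show ?thesis
    unfolding odd_symmetric_def total_size_def block_word_palindrome_iff[OF assms]
    using symmetric_sum_parity[of k d] by blast
qed

text \<open>For \<open>k \<ge> 3\<close> the first and the last letter \<open>E\<close> are
  distinct; they end the first block and begin the last one.\<close>

lemma block_word_core:
  assumes "k \<ge> 3" "\<forall>i\<in>{1..k}. d i > 0"
  obtains v where "block_word k d = replicate (d 1 - 1) False @ True # v @ True # replicate (d k - 1) False"
proof -
  let ?mid = "map d [2..<k]"
  have "[1..<k + 1] = [1..<k] @ [k]" using assms by simp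
  also have "[1..<k] = 1 # [2..<k]" using assms by (subst upt_conv_Cons) (simp_all add: numeral_2_eq_2)
  finally have "map d [1..<k + 1] = d 1 # ?mid @ [d k]" by simp
  moreover have "?mid \<noteq> []" using assms by simp
  ultimately have "block_word k d = replicate (d 1 - 1) False @ True # comp_word ?mid @ True # replicate (d k - 1) False"
    by (simp add: block_word_def comp_word_Cons comp_word_snoc del: upt_Suc)
  then show thesis by (rule that)
qed

text \<open>\<open>Min\<close> is meaningful only for a finite set; the ranks are bounded by the
  number of columns.\<close>

lemma min_block_rank_eqI:
  fixes X :: "'a::field mat"
  assumes "X \<in> h_alg k d" "block_proj d i j X \<noteq> 0\<^sub>m (d i) (d j)"
    and "vec_space.rank (d i) (block_proj d i j X) = m"
    and least: "\<And>Y :: 'a mat. Y \<in> h_alg k d \<Longrightarrow> block_proj d i j Y \<noteq> 0\<^sub>m (d i) (d j) \<Longrightarrow>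
      m \<le> vec_space.rank (d i) (block_proj d i j Y)"
  shows "min_block_rank TYPE('a) k d i j = m"
proof -
  let ?R = "{vec_space.rank (d i) (block_proj d i j Y) | Y.
    Y \<in> (h_alg k d :: 'a mat set) \<and> block_proj d i j Y \<noteq> 0\<^sub>m (d i) (d j)}"
  have "block_proj d i j Y \<in> carrier_mat (d i) (d j)" for Y :: "'a mat" by (simp add: block_proj_def)
  then have "?R \<subseteq> {..d j}" using vec_space.rank_le_nc by blast
  then have "finite ?R" by (rule finite_subset) simp
  then have "Min ?R = m"
    by (rule Min_eqI) (use assms in blast)+
  then show ?thesis using assms(1,2) by (auto simp: min_block_rank_def)
qed

section \<open>Reading ranks and nilpotency degrees off the word\<close>

context
  fixes k :: nat and d :: "nat \<Rightarrow> nat" and w :: "bool list" and n :: nat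
  assumes k: "k \<ge> 2" and pos: "\<forall>i\<in>{1..k}. d i > 0"
  defines "w \<equiv> block_word k d" and "n \<equiv> Suc (length w)"
begin

lemma n_eq: "total_size k d = n"
  using length_block_word[of k d] k pos by (simp add: w_def n_def)

lemma n_alg_eq: "n_alg k d = (word_n_alg w :: 'a::field mat set)"
  using k pos
  by (simp add: n_alg_def word_n_alg_def n_eq D_mat_letter_mat E_mat_letter_mat flip: w_def n_def)

lemma h_alg_eq: "h_alg k d = (word_h_alg w :: 'a::field mat set)"
  using k pos
  by (simp add: h_alg_def word_h_alg_def n_eq D_mat_letter_mat E_mat_letter_mat flip: w_def n_def)

lemma count_w: "count_list w True = k - 1"
  using count_block_word[of k d] k by (simp add: w_def)

lemma True_in_w: "True \<in> set w"
  using count_w k by (intro ccontr[of "True \<in> set w"]) (simp flip: count_list_0_iff)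

lemma False_in_w:
  assumes "\<not> (\<forall>i\<in>{1..k}. d i = 1)"
  shows "False \<in> set w"
proof (rule ccontr)
  assume "False \<notin> set w"
  then have "\<forall>a\<in>set (map d [1..<k + 1]). a = 1"
    unfolding w_def block_word_def using pos by (intro comp_word_no_False) auto
  then have "\<forall>i\<in>{1..k}. d i = 1" by (auto simp del: upt_Suc)
  then show False using assms by contradiction
qed

lemma all_ones_w: "\<forall>i\<in>{1..k}. d i = 1 \<Longrightarrow> w = replicate (k - 1) True"
proof -
  assume ones: "\<forall>i\<in>{1..k}. d i = 1"
  have "length w = k - 1" using n_eq ones by (simp add: total_size_def n_def)
  moreover have "z = True" if "z \<in> set w" for z
  proof (rule ccontr)
    assume "z \<noteq> True"
    then have "False \<in> set w" using that by simp
    then have "count_list w True < length w"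
      by (induction w) (auto simp: count_le_length le_imp_less_Suc)
    then show False using count_w calculation by simp
  qed
  ultimately show ?thesis by (intro replicate_eqI)
qed

lemma offset_first: "offset d 1 = 0"
  by (simp add: offset_def)

lemma offset_last: "offset d k + d k = n"
  using n_eq offset_Suc[of k d] k by (simp add: total_size_offset)

lemma d_first_le: "d 1 \<le> n"
  using n_eq member_le_sum[of 1 "{1..k}" d] k by (simp add: total_size_def)

lemma corner_index:
  "i < d 1 \<Longrightarrow> j < d k \<Longrightarrow> block_proj d 1 k X $$ (i, j) = X $$ (i, offset d k + j)"
  by (simp add: block_proj_def offset_first[simplified])

lemma corner_eq_zero_iff:
  "block_proj d 1 k X = 0\<^sub>m (d 1) (d k) \<longleftrightarrow> (\<forall>i<d 1. \<forall>j<d k. X $$ (i, offset d k + j) = 0)"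
  by (auto simp: mat_eq_iff block_proj_def offset_first[simplified])

lemmas corner_simps = corner_index[unfolded One_nat_def] corner_eq_zero_iff[unfolded One_nat_def]

lemma corner_carrier: "block_proj d 1 k X \<in> carrier_mat (d 1) (d k)"
  by (simp add: block_proj_def)

lemma min_rank_zero_if_corner_zero:
  assumes "\<And>X :: 'a::field mat. X \<in> word_h_alg w \<Longrightarrow> block_proj d 1 k X = 0\<^sub>m (d 1) (d k)"
  shows "min_block_rank TYPE('a) k d 1 k = 0"
  using assms by (simp add: min_block_rank_def h_alg_eq)

text \<open>A nonzero bracket with \<open>Suc m\<close> letters \<open>E\<close> witnesses that term
  \<open>m\<close> of the series does not vanish.\<close>

lemma nilpotency_degree_if_nonzero:
  assumes "(lie_mat w xs :: 'a::field mat) \<noteq> 0\<^sub>m n n" "count_list xs True = Suc m"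
    "lower_central n (word_n_alg w :: 'a mat set) (Suc m) = {0\<^sub>m n n}"
  shows "has_nilpotency_degree n (word_n_alg w :: 'a mat set) (Suc m)"
  unfolding n_def
proof (rule has_nilpotency_degreeI[OF word_n_alg_subalgebra])
  show "lower_central (Suc (length w)) (word_n_alg w :: 'a mat set) (Suc m) = {0\<^sub>m (Suc (length w)) (Suc (length w))}"
    using assms(3) by (simp only: n_def)
  have "(lie_mat w xs :: 'a mat) \<in> lower_central (Suc (length w)) (word_n_alg w) m"
    using lie_mat_in_lower_central[of xs w, where 'a='a] assms(2) by simp
  then show "lower_central (Suc (length w)) (word_n_alg w :: 'a mat set) m \<noteq> {0\<^sub>m (Suc (length w)) (Suc (length w))}"
    using assms(1) by (auto simp: n_def)
qed

lemma lower_central_top: "lower_central n (word_n_alg w :: 'a::field mat set) (k - 1) = {0\<^sub>m n n}"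
  unfolding n_def by (rule lower_central_top_zero) (simp add: count_w)

lemma full_degree_if_nonzero:
  assumes "(lie_mat w xs :: 'a::field mat) \<noteq> 0\<^sub>m n n" "count_list xs True = k - 1"
  shows "has_nilpotency_degree n (word_n_alg w :: 'a mat set) (k - 1)"
proof -
  have "k - 1 = Suc (k - 2)" using k by simp
  then show ?thesis
    using nilpotency_degree_if_nonzero[OF assms(1), of "k - 2"] assms(2) lower_central_top[where 'a='a] by simp
qed

lemma in_lie_support_w:
  assumes "\<not> odd_symmetric k d" "\<not> (k \<ge> 3 \<and> (\<forall>i\<in>{1..k}. d i = 1))"
  shows "in_lie_support w"
proof (cases "\<forall>i\<in>{1..k}. d i = 1")
  \<comment> \<open>Now \<open>w\<close> is a power of \<open>E\<close>. Only the letter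
    \<open>E\<close> itself, with \<open>k = 2\<close>, is left, and it is a Lie polynomial.\<close>
  case True
  then have "k = 2" using assms(2) k by simp
  then have "w = [True]" using all_ones_w[OF True] by simp
  then have "lie_coeff [True] w \<noteq> 0" by simp
  then show ?thesis unfolding in_lie_support_def by blast
next
  case False
  then show ?thesis
    using in_lie_support_if_not_even_palindrome[OF True_in_w False_in_w[OF False]]
      even_palindrome_iff_odd_symmetric[of k d] k pos assms(1) by (simp add: w_def)
qed

lemma window_full: "window w 0 (length w) = w"
  by (simp add: window_def)

lemma generic_case:
  assumes "\<not> odd_symmetric k d" "\<not> (k \<ge> 3 \<and> (\<forall>i\<in>{1..k}. d i = 1))"
  shows "has_nilpotency_degree n (word_n_alg w :: 'a::field_char_0 mat set) (k - 1)"
    and "min_block_rank TYPE('a) k d 1 k = 1"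
proof -
  obtain xs where xs: "lie_coeff xs w \<noteq> 0"
    using in_lie_support_w[OF assms] by (auto simp: in_lie_support_def)
  define X where "X = (lie_mat w xs :: 'a mat)"
  have len: "length xs = length w" using lie_coeff_length[OF xs] by simp
  have "(lie_mat w xs :: 'a mat) $$ (0, length w) = of_int (lie_coeff xs w)"
    using lie_mat_index[of 0 w "length w" xs] by (simp add: window_full)
  then have corner: "X $$ (0, length w) \<noteq> 0" using xs by (simp add: X_def)
  have other: "c = length w" "r = 0" if "r < n" "c < n" "X $$ (r, c) \<noteq> 0" for r c
    using lie_mat_index_length[of r w c xs, where 'a='a] that len by (auto simp: X_def n_def)
  \<comment> \<open>Since \<open>xs\<close> is a rearrangement of \<open>w\<close>, it uses all
    \<open>k - 1\<close> letters \<open>E\<close>, which places \<open>X\<close> in term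
    \<open>k - 2\<close>.\<close>
  have "count_list xs True = k - 1"
    using lie_coeff_mset[OF xs] count_w by (metis count_mset)
  moreover have "X \<noteq> 0\<^sub>m n n" using corner by (auto simp: n_def)
  ultimately show "has_nilpotency_degree n (word_n_alg w :: 'a mat set) (k - 1)"
    using full_degree_if_nonzero[of xs] by (simp add: X_def)
  have d1: "d 1 > 0" "d k > 0" using pos k by auto
  have last: "offset d k + (d k - 1) = length w" using offset_last d1 by (simp add: n_def)
  have ne: "block_proj d 1 k X $$ (0, d k - 1) \<noteq> 0" using corner last d1 by (simp add: corner_simps)
  show "min_block_rank TYPE('a) k d 1 k = 1"
  proof (rule min_block_rank_eqI)
    show "X \<in> h_alg k d" by (simp add: X_def h_alg_eq lie_mat_in_word_h_alg)
    show "block_proj d 1 k X \<noteq> 0\<^sub>m (d 1) (d k)" using ne d1 by auto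
    show ge: "1 \<le> vec_space.rank (d 1) (block_proj d 1 k Y)" if nonzero: "block_proj d 1 k Y \<noteq> 0\<^sub>m (d 1) (d k)" for Y :: "'a mat"
    proof -
      obtain i j where "i < d 1" "j < d k" "block_proj d 1 k Y $$ (i, j) \<noteq> 0"
        using nonzero by (auto simp: corner_simps)
      then show ?thesis using vec_space.rank_ge_1[OF corner_carrier] by blast
    qed
    have "vec_space.rank (d 1) (block_proj d 1 k X) \<le> 1"
    proof (rule vec_space.rank_le_1_single_entry[OF corner_carrier, where i = 0 and j = "d k - 1"])
      fix r c assume rc: "r < d 1" "c < d k" "(r, c) \<noteq> (0, d k - 1)"
      show "block_proj d 1 k X $$ (r, c) = 0"
      proof (rule ccontr)
        assume "block_proj d 1 k X $$ (r, c) \<noteq> 0"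
        then have "X $$ (r, offset d k + c) \<noteq> 0" using rc corner_index by metis
        moreover have "r < n" "offset d k + c < n" using rc d_first_le offset_last by auto
        ultimately have "r = 0" "offset d k + c = length w" using other by blast+
        then show False using rc last by auto
      qed
    qed
    moreover have "1 \<le> vec_space.rank (d 1) (block_proj d 1 k X)"
      by (rule ge) (use ne d1 in auto)
    ultimately show "vec_space.rank (d 1) (block_proj d 1 k X) = 1" by simp
  qed
qed

text \<open>Blocks of size 1 make \<open>D\<close> zero, so both algebras shrink to the line spanned
  by \<open>E\<close>.\<close>

lemma all_ones_case:
  assumes ones: "\<forall>i\<in>{1..k}. d i = 1"
  shows "(word_n_alg w :: 'a::field mat set) = {a \<cdot>\<^sub>m letter_mat w True | a. True}"
    and "(word_h_alg w :: 'a mat set) = {a \<cdot>\<^sub>m letter_mat w True | a. True}"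
    and "(letter_mat w True :: 'a mat) \<noteq> 0\<^sub>m n n"
proof -
  let ?E = "letter_mat w True :: 'a mat"
  let ?L = "{a \<cdot>\<^sub>m ?E | a. True}"
  have w: "w = replicate (k - 1) True" by (rule all_ones_w[OF ones])
  have E: "?E \<in> carrier_mat n n" unfolding n_def by (rule letter_mat_carrier)
  have D0: "(letter_mat w False :: 'a mat) = 0\<^sub>m n n"
    by (rule eq_matI) (auto simp: letter_mat_def n_def w)
  have br: "mat_bracket (a \<cdot>\<^sub>m ?E) (b \<cdot>\<^sub>m ?E) = 0\<^sub>m n n" for a b
    by (rule mat_bracket_multiples[OF E])
  have zero: "0\<^sub>m n n = 0 \<cdot>\<^sub>m ?E" using E by (intro eq_matI) auto
  have "mat_subspace n ?L"
    unfolding mat_subspace_def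
  proof (intro conjI ballI allI)
    fix X Y assume "X \<in> ?L" "Y \<in> ?L"
    then obtain a b where "X = a \<cdot>\<^sub>m ?E" "Y = b \<cdot>\<^sub>m ?E" by auto
    then have "X + Y = (a + b) \<cdot>\<^sub>m ?E" by (simp add: add_smult_distrib_right_mat[OF E])
    then show "X + Y \<in> ?L" by blast
  next
    fix c X assume "X \<in> ?L"
    then obtain a where "X = a \<cdot>\<^sub>m ?E" by auto
    then have "c \<cdot>\<^sub>m X = (c * a) \<cdot>\<^sub>m ?E" by (simp add: smult_smult_mat)
    then show "c \<cdot>\<^sub>m X \<in> ?L" by blast
  qed (use E zero in auto)
  moreover have "mat_bracket X Y \<in> ?L" if "X \<in> ?L" "Y \<in> ?L" for X Y
    using that br zero by fastforce
  ultimately have L: "lie_subalgebra n ?L" by (simp add: lie_subalgebra_iff)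
  have "?E = 1 \<cdot>\<^sub>m ?E" by (rule eq_matI) auto
  then have EL: "?E \<in> ?L" by blast
  have DL: "(letter_mat w False :: 'a mat) \<in> ?L" using zero unfolding D0 by blast
  have sub: "word_h_alg w \<subseteq> ?L"
    unfolding word_h_alg_def by (rule lie_generated_least) (use EL DL L in \<open>auto simp: n_def\<close>)
  have sup: "?L \<subseteq> word_n_alg w"
    using E_in_word_n_alg[of w, where 'a='a] word_n_alg_subalgebra[of w, where 'a='a]
    by (auto simp: lie_subalgebra_iff mat_subspace_def)
  show "word_n_alg w = ?L" "word_h_alg w = ?L"
    using sub sup word_n_alg_subset_h_alg[of w, where 'a='a] by blast+
  have "?E $$ (0, 1) = 1" using k by (simp add: letter_mat_def w)
  then show "?E \<noteq> 0\<^sub>m n n" using k by (auto simp: n_def w)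
qed

section \<open>Odd-symmetric sequences\<close>

lemma odd_symmetric_palindrome:
  assumes "odd_symmetric k d"
  shows "rev w = w" "odd n" "d 1 = d k" "k \<ge> 3"
proof -
  have "even (length w) \<and> rev w = w"
    using even_palindrome_iff_odd_symmetric[of k d] k pos assms by (simp add: w_def)
  then show "rev w = w" "odd n" by (simp_all add: n_def)
  have sym: "\<forall>i\<in>{1..k}. d i = d (k + 1 - i)" and "odd k"
    using assms unfolding odd_symmetric_def by blast+
  from sym have "d 1 = d (k + 1 - 1)" by (rule bspec) (use k in simp)
  then show "d 1 = d k" by simp
  show "k \<ge> 3" using k \<open>odd k\<close> by presburger
qed

text \<open>Since \<open>d 1 = d k\<close>, reflection in the antidiagonal of the whole matrix maps
  the corner block to itself. The sign involves \<open>offset d k\<close> because column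
  \<open>j\<close> of the block is column \<open>offset d k + j\<close> of \<open>X\<close>.\<close>

lemma corner_mirror:
  fixes X :: "'a::field_char_0 mat"
  assumes sym: "odd_symmetric k d" and X: "X \<in> word_h_alg w" and ij: "i < d 1" "j < d 1"
  shows "block_proj d 1 k X $$ (d 1 - 1 - j, d 1 - 1 - i) =
    (-1) ^ (i + j + offset d k + 1) * block_proj d 1 k X $$ (i, j)"
proof -
  note ps = odd_symmetric_palindrome[OF sym]
  have o: "offset d k + d 1 = n" using offset_last ps(3) by simp
  have "X \<in> antitranspose_skew n"
    using X word_h_alg_antitranspose_skew[OF ps(1), where 'a='a] by (auto simp: n_def)
  moreover have "i < n" "offset d k + j < n" using ij o by auto
  ultimately have "X $$ (n - 1 - (offset d k + j), n - 1 - i) =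
      (-1) ^ (i + (offset d k + j) + 1) * X $$ (i, offset d k + j)"
    by (rule antitranspose_skew_D)
  moreover have "n - 1 - (offset d k + j) = d 1 - 1 - j" "n - 1 - i = offset d k + (d 1 - 1 - i)"
    using ij o by auto
  moreover have "i + (offset d k + j) + 1 = i + j + offset d k + 1" by simp
  ultimately show ?thesis
    using ij ps(3) corner_index[of i j X] corner_index[of "d 1 - 1 - j" "d 1 - 1 - i" X]
    by (simp add: ac_simps)
qed

text \<open>An antidiagonal entry is its own mirror image, with sign \<open>-\<close> as
  \<open>n\<close> is odd; so twice the entry is 0.\<close>

lemma corner_antidiagonal:
  fixes X :: "'a::field_char_0 mat"
  assumes sym: "odd_symmetric k d" and X: "X \<in> word_h_alg w" and ij: "i < d 1" "j < d 1" "i + j = d 1 - 1"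
  shows "block_proj d 1 k X $$ (i, j) = 0"
proof -
  note ps = odd_symmetric_palindrome[OF sym]
  have "i + j + offset d k + 1 = n" using offset_last ps(3) ij by simp
  then have "odd (i + j + offset d k + 1)" using ps(2) by simp
  moreover have "d 1 - 1 - j = i" "d 1 - 1 - i = j" using ij by auto
  ultimately have "block_proj d 1 k X $$ (i, j) = - block_proj d 1 k X $$ (i, j)"
    using corner_mirror[OF sym X ij(1,2)] by simp
  then have "2 * block_proj d 1 k X $$ (i, j) = 0" by (metis add.right_inverse mult_2)
  then show ?thesis by simp
qed

text \<open>A nonzero entry and its mirror image span a 2 by 2 submatrix whose two other entries are
  antidiagonal and hence 0. This bound does the work of the evenness of the rank.\<close>

lemma corner_rank_ge_2:
  fixes X :: "'a::field_char_0 mat"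
  assumes sym: "odd_symmetric k d" and X: "X \<in> word_h_alg w" and "block_proj d 1 k X \<noteq> 0\<^sub>m (d 1) (d k)"
  shows "2 \<le> vec_space.rank (d 1) (block_proj d 1 k X)"
proof -
  note ps = odd_symmetric_palindrome[OF sym]
  obtain i j where ij: "i < d 1" "j < d 1" "block_proj d 1 k X $$ (i, j) \<noteq> 0"
    using assms(3) ps(3) by (auto simp: corner_simps)
  have "block_proj d 1 k X $$ (d 1 - 1 - j, d 1 - 1 - i) \<noteq> 0"
    using corner_mirror[OF sym X ij(1,2)] ij(3) by simp
  moreover have "block_proj d 1 k X $$ (i, d 1 - 1 - i) = 0" "block_proj d 1 k X $$ (d 1 - 1 - j, j) = 0"
    by (rule corner_antidiagonal[OF sym X]; use ij in simp)+
  ultimately show ?thesis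
    using vec_space.rank_ge_2[OF corner_carrier, where i = i and i' = "d 1 - 1 - j" and j = j and j' = "d 1 - 1 - i"] ij ps(3) by simp
qed

text \<open>An entry in term \<open>k - 2\<close> of the series has to pass all \<open>k - 1\<close>
  letters \<open>E\<close>. As \<open>w\<close> begins and ends with \<open>E\<close>, it sits in
  the upper right corner, where the skew symmetry makes it vanish.\<close>

lemma odd_symmetric_thin_case:
  assumes sym: "odd_symmetric k d" and d1: "d 1 = 1"
  shows "min_block_rank TYPE('a::field_char_0) k d 1 k = 0"
    and "lower_central n (word_n_alg w :: 'a mat set) (k - 2) = {0\<^sub>m n n}"
    and "\<not> (\<forall>i\<in>{1..k}. d i = 1) \<Longrightarrow> has_nilpotency_degree n (word_n_alg w :: 'a mat set) (k - 2)"
proof -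
  note ps = odd_symmetric_palindrome[OF sym]
  have dk: "d k = 1" using ps(3) d1 by simp
  have k3: "k \<ge> 3" by (rule ps(4))
  have zero: "block_proj d 1 k X = 0\<^sub>m (d 1) (d k)" if "X \<in> word_h_alg w" for X :: "'a mat"
    using corner_antidiagonal[OF sym that, of 0 0] corner_index[of 0 0 X] d1 dk
    unfolding corner_eq_zero_iff by simp
  then show "min_block_rank TYPE('a) k d 1 k = 0" by (rule min_rank_zero_if_corner_zero)
  obtain v where w: "w = True # v @ [True]"
    using block_word_core[OF k3 pos] d1 dk by (auto simp: w_def)
  show lc: "lower_central n (word_n_alg w :: 'a mat set) (k - 2) = {0\<^sub>m n n}"
  proof (subst subspace_zero_iff)
    show "mat_subspace n (lower_central n (word_n_alg w :: 'a mat set) (k - 2))"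
      unfolding n_def using lower_central_subspace[OF word_n_alg_subalgebra] by blast
    show "\<forall>X\<in>lower_central n (word_n_alg w :: 'a mat set) (k - 2). \<forall>r<n. \<forall>c<n. X $$ (r, c) = 0"
    proof (intro ballI allI impI, rule ccontr)
      fix X :: "'a mat" and r c
      assume X: "X \<in> lower_central n (word_n_alg w) (k - 2)" and rc: "r < n" "c < n" "X $$ (r, c) \<noteq> 0"
      have "X \<in> E_filtration w (Suc (k - 2))"
        using lower_central_E_filtration[of w "k - 2", where 'a='a] X by (auto simp: n_def)
      then have "count_list (take r w) True + Suc (k - 2) \<le> count_list (take c w) True"
        using rc by (intro E_filtration_D) (auto simp: n_def)
      then have le: "count_list (take r w) True + count_list w True \<le> count_list (take c w) True"
        using count_w k by simp
      have "count_list (take c w) True \<le> count_list w True" by (rule count_list_take_le)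
      then have "count_list (take r w) True = 0" using le by simp
      then have "r = 0" by (cases r) (auto simp: w)
      moreover have "c = length w"
      proof (rule ccontr)
        assume "c \<noteq> length w"
        then have "c \<le> length (True # v)" using rc by (simp add: w n_def)
        then have "take c ((True # v) @ [True]) = take c (True # v)" by (subst take_append) simp
        then have "take c w = take c (True # v)" by (simp add: w)
        then have "count_list (take c w) True \<le> count_list (True # v) True"
          by (simp only: count_list_take_le)
        then show False using le by (simp add: w)
      qed
      moreover have "X \<in> word_h_alg w"
        using X lower_central_subspace[OF word_n_alg_subalgebra[of w, where 'a='a], of "k - 2"]
          word_n_alg_subset_h_alg[of w, where 'a='a] by (auto simp: n_def)
      then have "X $$ (0, length w) = 0"
        using zero[of X] d1 dk offset_last unfolding corner_eq_zero_iff by (simp add: n_def)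
      ultimately show False using rc by simp
    qed
  qed
  assume "\<not> (\<forall>i\<in>{1..k}. d i = 1)"
  then have "False \<in> set w" by (rule False_in_w)
  \<comment> \<open>Without its last \<open>E\<close> the word has odd length, so some bracket
    contains it; its \<open>k - 2\<close> letters \<open>E\<close> show that term
    \<open>k - 3\<close> is nonzero.\<close>
  moreover have "odd (length (True # v))" using ps(2) by (simp add: n_def w)
  ultimately have "in_lie_support (True # v)"
    by (intro in_lie_support_if_not_even_palindrome) (auto simp: w)
  then obtain xs where xs: "lie_coeff xs (True # v) \<noteq> 0" by (auto simp: in_lie_support_def)
  have "window w 0 (length v + 1) = True # v" by (simp add: window_def w)
  then have "(lie_mat w xs :: 'a mat) $$ (0, length v + 1) \<noteq> 0"
    using lie_mat_index[of 0 w "length v + 1" xs, where 'a='a] xs by (simp add: w)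
  then have "(lie_mat w xs :: 'a mat) \<noteq> 0\<^sub>m n n" by (auto simp: n_def w)
  moreover have "count_list xs True = count_list (True # v) True"
    using lie_coeff_mset[OF xs] by (metis count_mset)
  then have "count_list xs True = Suc (k - 3)" using count_w k3 by (simp add: w)
  moreover have "Suc (k - 3) = k - 2" using k3 by simp
  ultimately show "has_nilpotency_degree n (word_n_alg w :: 'a mat set) (k - 2)"
    using nilpotency_degree_if_nonzero[of xs "k - 3", where 'a='a] lc by simp
qed

lemma odd_symmetric_thick_case:
  assumes sym: "odd_symmetric k d" and d1: "d 1 > 1"
  shows "min_block_rank TYPE('a::field_char_0) k d 1 k = 2"
    and "has_nilpotency_degree n (word_n_alg w :: 'a mat set) (k - 1)"
proof -
  note ps = odd_symmetric_palindrome[OF sym]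
  have k3: "k \<ge> 3" by (rule ps(4))
  define a where "a = d 1 - 2"
  have a: "d 1 = Suc (Suc a)" "d k = Suc (Suc a)" using d1 ps(3) by (auto simp: a_def)
  obtain v where w: "w = replicate (Suc a) False @ True # v @ True # replicate (Suc a) False"
    using block_word_core[OF k3 pos] a by (auto simp: w_def)
  \<comment> \<open>This factor of \<open>w\<close> runs from row \<open>a\<close>, the last but one
    of the first block, to the first column of the last block. It contains every \<open>E\<close>
    and, unlike \<open>w\<close>, has odd length.\<close>
  let ?u = "False # True # v @ [True]"
  have "odd (length ?u)" using ps(2) by (auto simp: n_def w)
  then have "in_lie_support ?u"
    by (intro in_lie_support_if_not_even_palindrome) auto
  then obtain xs where xs: "lie_coeff xs ?u \<noteq> 0" by (auto simp: in_lie_support_def)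
  define X where "X = (lie_mat w xs :: 'a mat)"
  have len: "length xs = length v + 3" using lie_coeff_length[OF xs] by simp
  have o: "offset d k = a + length v + 3" using offset_last a by (simp add: n_def w)
  have "w = replicate a False @ ?u @ replicate (Suc a) False"
    by (simp add: w replicate_app_Cons_same)
  then have "drop a w = ?u @ replicate (Suc a) False" by simp
  moreover have "take (length ?u) (?u @ replicate (Suc a) False) = ?u" by (subst take_append) simp
  moreover have "a + length v + 3 - a = length ?u" by simp
  ultimately have "window w a (a + length v + 3) = ?u" by (simp only: window_def)
  then have nz: "X $$ (a, offset d k) \<noteq> 0"
    using lie_mat_index[of a w "offset d k" xs, where 'a='a] xs by (simp add: w o X_def)
  have "count_list xs True = count_list ?u True"
    using lie_coeff_mset[OF xs] by (metis count_mset)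
  moreover have "count_list (replicate m False) True = 0" for m by (simp add: count_list_0_iff)
  ultimately have "count_list xs True = k - 1" using count_w by (simp add: w)
  moreover have "X \<noteq> 0\<^sub>m n n" using nz by (auto simp: n_def w o)
  ultimately show "has_nilpotency_degree n (word_n_alg w :: 'a mat set) (k - 1)"
    using full_degree_if_nonzero[of xs, where 'a='a] by (simp add: X_def)
  have Xh: "X \<in> word_h_alg w" by (simp add: X_def lie_mat_in_word_h_alg)
  show "min_block_rank TYPE('a) k d 1 k = 2"
  proof (rule min_block_rank_eqI)
    show "X \<in> h_alg k d" using Xh by (simp add: h_alg_eq)
    have "block_proj d 1 k X $$ (a, 0) \<noteq> 0" using nz a by (simp add: corner_simps)
    then show ne: "block_proj d 1 k X \<noteq> 0\<^sub>m (d 1) (d k)" using a by auto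
    show "2 \<le> vec_space.rank (d 1) (block_proj d 1 k Y)"
      if "Y \<in> h_alg k d" "block_proj d 1 k Y \<noteq> 0\<^sub>m (d 1) (d k)" for Y :: "'a mat"
      using that corner_rank_ge_2[OF sym, of Y] by (simp add: h_alg_eq)
    \<comment> \<open>The superdiagonal that supports \<open>X\<close> meets the corner block only
      in \<open>(a, 0)\<close> and in its mirror image \<open>(Suc a, 1)\<close>.\<close>
    have "vec_space.rank (d 1) (block_proj d 1 k X) \<le> 2"
    proof (rule vec_space.rank_le_2_two_entries[OF corner_carrier, where i = a and j = 0 and i' = "Suc a" and j' = 1])
      fix r c assume rc: "r < d 1" "c < d k" "(r, c) \<noteq> (a, 0)" "(r, c) \<noteq> (Suc a, 1)"
      show "block_proj d 1 k X $$ (r, c) = 0"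
      proof (rule ccontr)
        assume "block_proj d 1 k X $$ (r, c) \<noteq> 0"
        then have "offset d k + c = r + length xs"
          using lie_mat_index_length[of r w "offset d k + c" xs, where 'a='a] rc offset_last d_first_le
          by (simp add: corner_simps X_def n_def)
        then show False using rc a by (auto simp: o len)
      qed
    qed
    then show "vec_space.rank (d 1) (block_proj d 1 k X) = 2"
      using corner_rank_ge_2[OF sym Xh ne] by simp
  qed
qed

lemma all_ones_facts:
  assumes ones: "\<forall>i\<in>{1..k}. d i = 1"
  shows "lie_abelian n (word_n_alg w :: 'a::field mat set)"
    and "mat_subspace_dim n (word_n_alg w :: 'a mat set) = 1"
    and "k \<ge> 3 \<Longrightarrow> min_block_rank TYPE('a) k d 1 k = 0"
    and "k \<ge> 3 \<Longrightarrow> \<not> has_nilpotency_degree n (word_n_alg w :: 'a mat set) (k - 1)"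
proof -
  let ?E = "letter_mat w True :: 'a mat"
  note ao = all_ones_case[OF ones, where 'a='a]
  have E: "?E \<in> carrier_mat n n" unfolding n_def by (rule letter_mat_carrier)
  show ab: "lie_abelian n (word_n_alg w :: 'a mat set)"
    unfolding ao lie_abelian_def by (auto simp: mat_bracket_multiples[OF E])
  show "mat_subspace_dim n (word_n_alg w :: 'a mat set) = 1"
  proof -
    interpret mv: matrix_vs n n "TYPE('a)" .
    have lc: "mv.lincomb a {?E} = a ?E \<cdot>\<^sub>m ?E" for a
      unfolding mv.lincomb_def using E by simp
    have li: "mv.lin_indpt {?E}"
      using ao(3) E by (intro mv.finite_lin_indpt2) (auto simp: lc dest: smult_mat_eq_zeroD)
    have "mv.span {?E} = {a \<cdot>\<^sub>m ?E | a. True}"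
      using mv.finite_span[of "{?E}"] E by (auto simp: lc intro: exI[of _ "\<lambda>_. _"])
    moreover have "vectorspace.dim class_ring (mv.span_vs {?E}) = card {?E}"
      using E li by (intro mv.dim_span) (auto simp: maximal_def)
    ultimately show ?thesis by (simp add: mat_subspace_dim_def ao(1))
  qed
  assume k3: "k \<ge> 3"
  then have less: "1 < k - 1" by simp
  have d1: "d 1 = 1" "d k = 1" using ones k by auto
  show "min_block_rank TYPE('a) k d 1 k = 0"
  proof (rule min_rank_zero_if_corner_zero)
    fix X :: "'a mat" assume "X \<in> word_h_alg w"
    then obtain a where X: "X = a \<cdot>\<^sub>m ?E" unfolding ao(2) by blast
    \<comment> \<open>The corner entry is in position \<open>(0, k - 1)\<close>, off the
      superdiagonal because \<open>k \<ge> 3\<close>.\<close>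
    have "length w = k - 1" by (simp add: all_ones_w[OF ones])
    then have "X $$ (0, offset d k) = 0"
      using k3 d1 offset_last E by (auto simp: X n_def letter_mat_def)
    then show "block_proj d 1 k X = 0\<^sub>m (d 1) (d k)" using d1 unfolding corner_eq_zero_iff by simp
  qed
  \<comment> \<open>An abelian algebra has zero first term, and \<open>1 < k - 1\<close>, so the
    degree cannot be \<open>k - 1\<close>.\<close>
  have "{mat_bracket X Y |X Y. X \<in> word_n_alg w \<and> Y \<in> (word_n_alg w :: 'a mat set)} \<subseteq> {0\<^sub>m n n}"
    using ab by (auto simp: lie_abelian_def)
  then have "lower_central n (word_n_alg w :: 'a mat set) 1 \<subseteq> {0\<^sub>m n n}"
    using mat_span_least[of _ "{0\<^sub>m n n}" n] by (simp add: mat_subspace_def)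
  moreover have "0\<^sub>m n n \<in> lower_central n (word_n_alg w :: 'a mat set) 1"
    using lower_central_subspace[OF word_n_alg_subalgebra[of w, where 'a='a], of 1]
    by (simp add: mat_subspace_def n_def del: lower_central.simps)
  ultimately have "lower_central n (word_n_alg w :: 'a mat set) 1 = {0\<^sub>m n n}" by blast
  then show "\<not> has_nilpotency_degree n (word_n_alg w :: 'a mat set) (k - 1)"
    using less unfolding has_nilpotency_degree_def by blast
qed

end

text \<open>For \<open>d = (1, 1)\<close> the corner block is the nonzero entry of \<open>E\<close>,
  so \<open>r 1 k = 1\<close>; hence the bound \<open>k \<ge> 3\<close> in the first alternative for
  \<open>r 1 k = 0\<close>.\<close>

theorem theorem3p13:
  fixes k :: nat and d :: "nat \<Rightarrow> nat"
  defines "N \<equiv> total_size k d"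
    and "\<nn> \<equiv> (n_alg k d :: 'a::field_char_0 mat set)"
    and "r \<equiv> min_block_rank TYPE('a) k d"
  assumes "k \<ge> 2"
    and "\<forall>i\<in>{1..k}. d i > 0"
  shows "(has_nilpotency_degree N \<nn> (k - 1) \<longleftrightarrow> r 1 k \<noteq> 0) \<and>
    (r 1 k = 0 \<longleftrightarrow>
      (k \<ge> 3 \<and> (\<forall>i\<in>{1..k}. d i = 1)) \<or>
      (odd k \<and> odd_symmetric k d \<and> d 1 = 1 \<and> d k = 1)) \<and>
    ((\<forall>i\<in>{1..k}. d i = 1) \<longrightarrow> mat_subspace_dim N \<nn> = 1 \<and> lie_abelian N \<nn>) \<and>
    (odd k \<and> odd_symmetric k d \<and> d 1 = 1 \<and> d k = 1 \<and> \<not> (\<forall>i\<in>{1..k}. d i = 1) \<longrightarrow>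
      has_nilpotency_degree N \<nn> (k - 2)) \<and>
    (r 1 k = 2 \<longleftrightarrow> odd k \<and> odd_symmetric k d \<and> d 1 = d k \<and> d 1 > 1)"
proof -
  let ?ones = "\<forall>i\<in>{1..k}. d i = 1"
  note A = \<open>k \<ge> 2\<close> \<open>\<forall>i\<in>{1..k}. d i > 0\<close>
  have N: "N = Suc (length (block_word k d))" and nn: "\<nn> = word_n_alg (block_word k d)"
    using n_eq[OF A] n_alg_eq[OF A] by (simp_all add: N_def \<nn>_def)
  have oddk: "odd_symmetric k d \<Longrightarrow> odd k" by (simp add: odd_symmetric_def)
  have ones_ends: "?ones \<Longrightarrow> d 1 = 1 \<and> d k = 1" using A by auto
  have ones: "?ones \<longrightarrow> mat_subspace_dim N \<nn> = 1 \<and> lie_abelian N \<nn>"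
    using all_ones_facts(1,2)[OF A, where 'a='a] by (simp add: N nn)
  \<comment> \<open>A constant sequence of ones with odd \<open>k\<close> is odd-symmetric and falls
    under \<open>thin\<close>; the case \<open>ones\<close> covers the even
    \<open>k \<ge> 4\<close>.\<close>
  consider (generic) "\<not> odd_symmetric k d" "\<not> (k \<ge> 3 \<and> ?ones)"
    | (ones) "\<not> odd_symmetric k d" "k \<ge> 3" "?ones"
    | (thin) "odd_symmetric k d" "d 1 = 1"
    | (thick) "odd_symmetric k d" "d 1 > 1"
  proof -
    have "d 1 > 0" using A by simp
    then have "d 1 = 1 \<or> d 1 > 1" by linarith
    then show ?thesis using that by blast
  qed
  then show ?thesis
  proof cases
    case generic
    then have "has_nilpotency_degree N \<nn> (k - 1)" "r 1 k = 1"
      using generic_case[OF A generic, where 'a='a] by (simp_all add: N nn r_def)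
    then show ?thesis using generic ones by auto
  next
    case ones
    then have "\<not> has_nilpotency_degree N \<nn> (k - 1)" "r 1 k = 0"
      using all_ones_facts(3,4)[OF A ones(3,2), where 'a='a] by (simp_all add: N nn r_def)
    then show ?thesis using ones \<open>?ones \<longrightarrow> _\<close> by auto
  next
    case thin
    note T = odd_symmetric_thin_case[OF A thin, where 'a='a]
    have "r 1 k = 0" using T(1) by (simp add: r_def)
    moreover have "d k = 1" using odd_symmetric_palindrome(3)[OF A thin(1)] thin(2) by simp
    moreover have "\<not> has_nilpotency_degree N \<nn> (k - 1)"
    proof -
      have "k - 2 < k - 1" using A by simp
      then show ?thesis using T(2) unfolding has_nilpotency_degree_def N nn by blast
    qed
    moreover have "\<not> ?ones \<Longrightarrow> has_nilpotency_degree N \<nn> (k - 2)"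
      using T(3) by (simp add: N nn)
    ultimately show ?thesis using thin oddk ones by simp
  next
    case thick
    then have "has_nilpotency_degree N \<nn> (k - 1)" "r 1 k = 2"
      using odd_symmetric_thick_case[OF A thick, where 'a='a] by (simp_all add: N nn r_def)
    moreover have "d 1 = d k" by (rule odd_symmetric_palindrome(3)[OF A thick(1)])
    ultimately show ?thesis using thick oddk ones ones_ends by auto
  qed
qed

end
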